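(* Let $\Omega\subset\mathbb{R}^N$, $N\geq2$, be a smooth bounded domain. Let $s:\mathbb{R}^N\times\mathbb{R}^N\to\mathbb{R}$ be continuous and symmetric with $0<s^-\leq s^+<1$, and $p\in C_+(\mathbb{R}^N\times\mathbb{R}^N)$ continuous and symmetric with $s^+p^+<N$. Let $\beta\in C_+(\overline\Omega)$ with $\beta(x)\geq p(x,x)$ for all $x\in\overline\Omega$, and let $\gamma\in C_+(\overline\Omega)$ with $\gamma(x)<p_s^*(x):=\frac{Np(x,x)}{N-s(x,x)p(x,x)}$ for all $x\in\overline\Omega$. Then there exists a constant $K=K(N,s,p,\beta,\gamma,\Omega)>0$ such that $\|u\|_{L^{\gamma(x)}(\Omega)}\leq K\|u\|_W$ for every $u\in W$. Moreover, this embedding of $W$ into $L^{\gamma(x)}(\Omega)$ is compact.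
   Context: $\Phi^\pm$ denote $\sup/\inf$ of $\Phi$ over its domain; $C_+(\mathcal D)=\{\Phi\in C(\mathcal D,\mathbb{R}):1<\Phi^-\leq\Phi^+<\infty\}$. $W=W^{s(x,y),\beta(x),p(x,y)}(\Omega)$ is the set of $u\in L^{\beta(x)}(\Omega)$ such that $\int_{\Omega\times\Omega}\frac{|u(x)-u(y)|^{p(x,y)}}{\lambda^{p(x,y)}|x-y|^{N+s(x,y)p(x,y)}}dxdy<\infty$ for some $\lambda>0$, with norm $\|u\|_W=\|u\|_{L^{\beta(x)}(\Omega)}+[u]_\Omega^{s(x,y),p(x,y)}$, where $[u]_\Omega^{s(x,y),p(x,y)}=\inf\{\lambda>0:\int_{\Omega\times\Omega}\frac{|u(x)-u(y)|^{p(x,y)}}{\lambda^{p(x,y)}|x-y|^{N+s(x,y)p(x,y)}}dxdy<1\}$. $L^{\gamma(x)}$ is the variable exponent Lebesgue space with Luxemburg norm. *)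

theory Defs
  imports "HOL-Analysis.Analysis"
begin

coinductive smooth_on :: "('a::euclidean_space) set \<Rightarrow> ('a \<Rightarrow> real) \<Rightarrow> bool" where
  "\<lbrakk> f differentiable_on U; continuous_on U f;
     \<forall>i\<in>Basis. smooth_on U (\<lambda>x. frechet_derivative f (at x) i) \<rbrakk>
   \<Longrightarrow> smooth_on U f"

definition smooth_bounded_domain :: "('a::euclidean_space) set \<Rightarrow> bool" where
  "smooth_bounded_domain \<Omega> \<longleftrightarrow> open \<Omega> \<and> connected \<Omega> \<and> \<Omega> \<noteq> {} \<and> bounded \<Omega> \<and>
     (\<forall>x0\<in>frontier \<Omega>. \<exists>U \<phi>. open U \<and> x0 \<in> U \<and> smooth_on U \<phi> \<and>
        frechet_derivative \<phi> (at x0) \<noteq> (\<lambda>_. 0) \<and>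
        \<Omega> \<inter> U = {x\<in>U. \<phi> x < 0})"

definition C_plus :: "'b::topological_space set \<Rightarrow> ('b \<Rightarrow> real) \<Rightarrow> bool" where
  "C_plus D \<Phi> \<longleftrightarrow> continuous_on D \<Phi> \<and> bdd_above (\<Phi> ` D) \<and> bdd_below (\<Phi> ` D) \<and>
     1 < Inf (\<Phi> ` D)"

definition var_modular :: "('a::euclidean_space) set \<Rightarrow> ('a \<Rightarrow> real) \<Rightarrow> ('a \<Rightarrow> real) \<Rightarrow> ennreal" where
  "var_modular \<Omega> \<gamma> u = (\<integral>\<^sup>+ x \<in> \<Omega>. ennreal (\<bar>u x\<bar> powr \<gamma> x) \<partial>lebesgue)"

definition Lvar :: "('a::euclidean_space) set \<Rightarrow> ('a \<Rightarrow> real) \<Rightarrow> ('a \<Rightarrow> real) set" where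
  "Lvar \<Omega> \<gamma> = {u. set_borel_measurable lebesgue \<Omega> u \<and>
      (\<exists>c>0. var_modular \<Omega> \<gamma> (\<lambda>x. u x / c) < \<infinity>)}"

definition lux_norm :: "('a::euclidean_space) set \<Rightarrow> ('a \<Rightarrow> real) \<Rightarrow> ('a \<Rightarrow> real) \<Rightarrow> real" where
  "lux_norm \<Omega> \<gamma> u = Inf {c. 0 < c \<and> var_modular \<Omega> \<gamma> (\<lambda>x. u x / c) \<le> 1}"

definition gag_modular :: "('a::euclidean_space) set \<Rightarrow> ('a \<Rightarrow> 'a \<Rightarrow> real) \<Rightarrow> ('a \<Rightarrow> 'a \<Rightarrow> real)
    \<Rightarrow> ('a \<Rightarrow> real) \<Rightarrow> ennreal" where
  "gag_modular \<Omega> s p u = (\<integral>\<^sup>+ x \<in> \<Omega>. (\<integral>\<^sup>+ y \<in> \<Omega>.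
      ennreal (\<bar>u x - u y\<bar> powr p x y / (norm (x - y) powr (real DIM('a) + s x y * p x y)))
      \<partial>lebesgue) \<partial>lebesgue)"

definition gag_seminorm :: "('a::euclidean_space) set \<Rightarrow> ('a \<Rightarrow> 'a \<Rightarrow> real) \<Rightarrow> ('a \<Rightarrow> 'a \<Rightarrow> real)
    \<Rightarrow> ('a \<Rightarrow> real) \<Rightarrow> real" where
  "gag_seminorm \<Omega> s p u = Inf {c. 0 < c \<and> gag_modular \<Omega> s p (\<lambda>x. u x / c) < 1}"

definition Wspace :: "('a::euclidean_space) set \<Rightarrow> ('a \<Rightarrow> 'a \<Rightarrow> real) \<Rightarrow> ('a \<Rightarrow> real)
    \<Rightarrow> ('a \<Rightarrow> 'a \<Rightarrow> real) \<Rightarrow> ('a \<Rightarrow> real) set" where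
  "Wspace \<Omega> s \<beta> p = {u \<in> Lvar \<Omega> \<beta>. \<exists>c>0. gag_modular \<Omega> s p (\<lambda>x. u x / c) < \<infinity>}"

definition W_norm :: "('a::euclidean_space) set \<Rightarrow> ('a \<Rightarrow> 'a \<Rightarrow> real) \<Rightarrow> ('a \<Rightarrow> real)
    \<Rightarrow> ('a \<Rightarrow> 'a \<Rightarrow> real) \<Rightarrow> ('a \<Rightarrow> real) \<Rightarrow> real" where
  "W_norm \<Omega> s \<beta> p u = lux_norm \<Omega> \<beta> u + gag_seminorm \<Omega> s p u"

definition crit_exp :: "('a::euclidean_space \<Rightarrow> 'a \<Rightarrow> real) \<Rightarrow> ('a \<Rightarrow> 'a \<Rightarrow> real) \<Rightarrow> 'a \<Rightarrow> real" where
  "crit_exp s p x = real DIM('a) * p x x / (real DIM('a) - s x x * p x x)"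

end

theory Submission
  imports Defs "HOL-Complex_Analysis.Great_Picard"
begin

text \<open>
  No extension theorem and no constant-exponent fractional Sobolev inequality is needed. A smooth
  bounded domain has the measure density property: the part of \<open>\<Omega>\<close> in a ball of small radius \<open>r\<close>
  centred in \<open>\<Omega>\<close> has measure at least \<open>c r\<^sup>N\<close>. Let \<open>G x\<close> be the inner integral of the Gagliardo
  modular and let \<open>p\<^sub>0\<close>, \<open>s\<^sub>0\<close> be local lower bounds of \<open>p\<close>, \<open>s\<close>. Averaging over
  \<open>\<Omega> \<inter> B(x, r)\<close> gives
  \<open>|u x| \<le> C (r\<^bsup>-N/q\<^esup> \<parallel>u\<parallel>\<^sub>q + r\<^bsup>s\<^sub>0\<^esup> (1 + G x)\<^bsup>1/p\<^sub>0\<^esup>)\<close>,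
  and optimising in \<open>r\<close> turns a local \<open>L\<^sup>q\<close> bound into a local \<open>L\<^bsup>q'\<^esup>\<close> bound with
  \<open>q' = p\<^sub>0 + (s\<^sub>0 p\<^sub>0 / N) q\<close>. The fixed point of this affine contraction is the critical
  exponent \<open>N p\<^sub>0 / (N - s\<^sub>0 p\<^sub>0)\<close>, so finitely many steps starting at \<open>q = 1\<close> reach every
  subcritical exponent.

  For compactness, the same averaging shows that \<open>u\<close> is within \<open>C r\<^bsup>\<sigma>\<^esup>\<close> in \<open>L\<^sup>1\<close> of its averages over
  balls centred at a finite \<open>r\<close>-net. A diagonal argument makes all these averages converge, which
  yields \<open>L\<^sup>1\<close> convergence of a subsequence; interpolation with a bound for the modular with exponent
  \<open>\<gamma> + \<epsilon>\<close> upgrades it to \<open>L\<^bsup>\<gamma>(x)\<^esup>\<close>.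
\<close>

section \<open>Measure density of smooth domains\<close>

text \<open>Some direction \<open>e\<close> has strictly negative derivative at \<open>x0\<close>.
  Since \<open>smooth_on\<close> provides continuous partial derivatives, the derivative at
  \<open>x\<close> in direction \<open>w\<close> stays negative for \<open>x\<close> near
  \<open>x0\<close> and \<open>w\<close> near \<open>e\<close>, so \<open>\<phi>\<close> cannot
  increase along short segments in these directions.\<close>

lemma smooth_on_imp_interior_cone:
  fixes \<phi> :: "'a::euclidean_space \<Rightarrow> real"
  assumes U: "open U" "x0 \<in> U" and sm: "smooth_on U \<phi>"
    and nz: "frechet_derivative \<phi> (at x0) \<noteq> (\<lambda>_. 0)"
  obtains e \<delta> where "norm e = 1" "0 < \<delta>" "\<delta> \<le> 1"
    "\<And>x w t. \<lbrakk>x \<in> ball x0 \<delta>; w \<in> ball e \<delta>; 0 \<le> t; t \<le> \<delta>\<rbrakk> \<Longrightarrow> x + t *\<^sub>R w \<in> U \<and> \<phi> (x + t *\<^sub>R w) \<le> \<phi> x"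
proof -
  let ?D = "\<lambda>x. frechet_derivative \<phi> (at x)"
  have diff: "\<phi> differentiable_on U" and contD: "\<And>i. i \<in> Basis \<Longrightarrow> continuous_on U (\<lambda>x. ?D x i)"
    using sm by (auto elim: smooth_on.cases)
  have D: "(\<phi> has_derivative ?D x) (at x)" if "x \<in> U" for x
    using diff U that by (metis at_within_open differentiable_on_def frechet_derivative_works)
  have lin: "linear (?D x)" if "x \<in> U" for x
    using D[OF that] has_derivative_linear by blast
  obtain a where a: "?D x0 a \<noteq> 0" using nz by auto
  define b where "b = (if ?D x0 a < 0 then a else - a)"
  have b: "?D x0 b < 0" using a linear_neg[OF lin[OF U(2)]] unfolding b_def by auto
  then have "b \<noteq> 0" using linear_0[OF lin[OF U(2)]] by auto
  define e where "e = b /\<^sub>R norm b"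
  have e: "norm e = 1" "?D x0 e < 0"
    using \<open>b \<noteq> 0\<close> b linear_scale[OF lin[OF U(2)]] by (auto simp: e_def divide_neg_pos mult_pos_neg)
  \<comment> \<open>Expansion in the basis: joint continuity in the point and the direction then
    follows from continuity of finitely many partial derivatives.\<close>
  define F where "F = (\<lambda>(x, w). \<Sum>i\<in>Basis. (w \<bullet> i) * ?D x i)"
  have F: "?D x w = F (x, w)" if "x \<in> U" for x w
  proof -
    have "?D x w = ?D x (\<Sum>i\<in>Basis. (w \<bullet> i) *\<^sub>R i)" by (simp add: euclidean_representation)
    also have "\<dots> = F (x, w)"
      unfolding F_def using lin[OF that] by (simp add: linear_sum linear_scale)
    finally show ?thesis .
  qed
  have contF: "continuous_on (U \<times> UNIV) F"
    unfolding F_def case_prod_unfold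
    by (intro continuous_intros continuous_on_compose2[OF contD]) auto
  have "open ((U \<times> UNIV) \<inter> F -` {..<0})"
    by (rule continuous_open_preimage[OF contF]) (auto simp: U open_Times)
  moreover have "(x0, e) \<in> (U \<times> UNIV) \<inter> F -` {..<0}" using e U F by auto
  ultimately obtain d where "d > 0" and d: "ball (x0, e) d \<subseteq> (U \<times> UNIV) \<inter> F -` {..<0}"
    using open_contains_ball_eq by blast
  have neg: "x \<in> U \<and> ?D x w < 0" if "x \<in> ball x0 (d/2)" "w \<in> ball e (d/2)" for x w
  proof -
    have "dist (x0, e) (x, w) \<le> dist x0 x + dist e w"
      unfolding dist_Pair_Pair by (rule sqrt_sum_squares_le_sum) auto
    then have "(x, w) \<in> ball (x0, e) d" using that by auto
    then have "(x, w) \<in> (U \<times> UNIV) \<inter> F -` {..<0}" using d by blast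
    then show ?thesis using F by auto
  qed
  \<comment> \<open>Directions near \<open>e\<close> have norm at most \<open>2\<close>, so a
    segment with \<open>t \<le> \<delta>\<close> stays within \<open>3 * \<delta> < d/2\<close> of
    \<open>x0\<close>.\<close>
  define \<delta> where "\<delta> = min 1 (d/8)"
  have \<delta>: "0 < \<delta>" "\<delta> \<le> 1" "\<delta> \<le> d/8" using \<open>d > 0\<close> by (auto simp: \<delta>_def)
  show ?thesis
  proof (rule that[OF e(1) \<delta>(1,2)])
    fix x w t assume x: "x \<in> ball x0 \<delta>" and w: "w \<in> ball e \<delta>" and t: "0 \<le> t" "t \<le> \<delta>"
    have nw: "norm w \<le> 2"
      using w e \<delta> norm_triangle_ineq2[of w e] by (auto simp: dist_norm norm_minus_commute)
    have seg: "x + \<tau> *\<^sub>R w \<in> ball x0 (d/2)" if "0 \<le> \<tau>" "\<tau> \<le> t" for \<tau>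
    proof -
      have "dist x0 (x + \<tau> *\<^sub>R w) \<le> dist x0 x + norm (\<tau> *\<^sub>R w)"
        by (metis dist_triangle dist_add_cancel add.right_neutral dist_0_norm)
      also have "norm (\<tau> *\<^sub>R w) \<le> \<delta> * 2"
        using that t nw by (simp add: mult_mono)
      finally show ?thesis using x \<delta> \<open>d > 0\<close> by auto
    qed
    have wd: "w \<in> ball e (d/2)" using w \<delta> \<open>d > 0\<close> by auto
    have "\<phi> (x + t *\<^sub>R w) \<le> \<phi> (x + 0 *\<^sub>R w)"
    proof (rule DERIV_nonpos_imp_nonincreasing[OF t(1)])
      fix \<tau> assume \<tau>: "0 \<le> \<tau>" "\<tau> \<le> t"
      have "((\<lambda>\<tau>. \<phi> (x + \<tau> *\<^sub>R w)) has_derivative (\<lambda>h. ?D (x + \<tau> *\<^sub>R w) (h *\<^sub>R w))) (at \<tau>)"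
        using neg[OF seg[OF \<tau>] wd]
        by (auto intro!: derivative_eq_intros has_derivative_compose[OF _ D])
      moreover have "(\<lambda>h. ?D (x + \<tau> *\<^sub>R w) (h *\<^sub>R w)) = (*) (?D (x + \<tau> *\<^sub>R w) w)"
        using neg[OF seg[OF \<tau>] wd] linear_scale[OF lin] by auto
      ultimately show "\<exists>y. ((\<lambda>\<tau>. \<phi> (x + \<tau> *\<^sub>R w)) has_real_derivative y) (at \<tau>) \<and> y \<le> 0"
        using neg[OF seg[OF \<tau>] wd] by (auto simp: has_field_derivative_def intro!: exI less_imp_le)
    qed
    then show "x + t *\<^sub>R w \<in> U \<and> \<phi> (x + t *\<^sub>R w) \<le> \<phi> x"
      using neg[OF seg[OF t(1)] wd] by auto
  qed
qed

text \<open>Near an interior point a ball about \<open>x\<close> itself works. Near a boundary point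
  one moves from \<open>x\<close> by \<open>r/2\<close> in the inward direction \<open>e\<close> of
  the cone lemma, where the defining function stays negative. Compactness of the closure makes the
  constants uniform.\<close>

lemma smooth_bounded_domain_corkscrew:
  fixes \<Omega> :: "'a::euclidean_space set"
  assumes "smooth_bounded_domain \<Omega>"
  obtains \<eta> R where "0 < \<eta>" "0 < R" "R \<le> 1"
    "\<And>x r. \<lbrakk>x \<in> \<Omega>; 0 < r; r \<le> R\<rbrakk> \<Longrightarrow> \<exists>z. ball z (\<eta> * r) \<subseteq> \<Omega> \<inter> ball x r"
proof -
  have op: "open \<Omega>" and bd: "bounded \<Omega>" using assms by (auto simp: smooth_bounded_domain_def)
  \<comment> \<open>A single \<open>\<delta>\<close> is the radius of the neighbourhood, the ratio
    of the radii and the bound on \<open>r\<close>, so that one minimum over a finite subcover can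
    serve as both constants at the end.\<close>
  have loc: "\<exists>\<delta>>0. \<forall>x r. x \<in> \<Omega> \<inter> ball x0 \<delta> \<longrightarrow> 0 < r \<longrightarrow> r \<le> \<delta> \<longrightarrow> (\<exists>z. ball z (\<delta> * r) \<subseteq> \<Omega> \<inter> ball x r)"
    if x0: "x0 \<in> closure \<Omega>" for x0
  proof (cases "x0 \<in> \<Omega>")
    case True
    then obtain d where d: "d > 0" "ball x0 d \<subseteq> \<Omega>" using op open_contains_ball by blast
    have "\<exists>z. ball z (min 1 (d/2) * r) \<subseteq> \<Omega> \<inter> ball x r"
      if "x \<in> ball x0 (min 1 (d/2))" "0 < r" "r \<le> min 1 (d/2)" for x r
    proof (intro exI subsetI)
      fix y assume y: "y \<in> ball x (min 1 (d/2) * r)"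
      have "min 1 (d/2) * r \<le> r" using that d by (simp add: mult_le_cancel_right1)
      then have "dist x y < r" using y by auto
      moreover have "dist x0 y \<le> dist x0 x + dist x y" by (rule dist_triangle)
      ultimately show "y \<in> \<Omega> \<inter> ball x r" using that d by auto
    qed
    then show ?thesis using d by (intro exI[of _ "min 1 (d/2)"] conjI allI impI) (simp, blast)
  next
    case False
    then have "x0 \<in> frontier \<Omega>" using x0 op by (simp add: frontier_def interior_open)
    then obtain U \<phi> where U: "open U" "x0 \<in> U" and sm: "smooth_on U \<phi>"
      and nz: "frechet_derivative \<phi> (at x0) \<noteq> (\<lambda>_. 0)" and eq: "\<Omega> \<inter> U = {x\<in>U. \<phi> x < 0}"
      using assms unfolding smooth_bounded_domain_def by meson
    obtain e \<delta> where e: "norm e = 1" and \<delta>: "0 < \<delta>" "\<delta> \<le> 1"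
      and cone: "\<And>x w t. \<lbrakk>x \<in> ball x0 \<delta>; w \<in> ball e \<delta>; 0 \<le> t; t \<le> \<delta>\<rbrakk> \<Longrightarrow>
         x + t *\<^sub>R w \<in> U \<and> \<phi> (x + t *\<^sub>R w) \<le> \<phi> x"
      using smooth_on_imp_interior_cone[OF U sm nz] by blast
    have "ball (x + (r/2) *\<^sub>R e) (\<delta>/2 * r) \<subseteq> \<Omega> \<inter> ball x r"
      if "x \<in> \<Omega> \<inter> ball x0 (\<delta>/2)" "0 < r" "r \<le> \<delta>/2" for x r
    proof
      fix y assume y: "y \<in> ball (x + (r/2) *\<^sub>R e) (\<delta>/2 * r)"
      \<comment> \<open>Rescaling by \<open>2/r\<close> carries the small ball to
        \<open>ball e \<delta>\<close>; the cone lemma then applies with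
        \<open>t = r/2\<close>.\<close>
      define w where "w = (2/r) *\<^sub>R (y - x)"
      have yw: "y = x + (r/2) *\<^sub>R w" using that by (simp add: w_def)
      have "dist (x + (r/2) *\<^sub>R e) y = r/2 * dist e w"
        using that unfolding yw by (simp add: dist_norm flip: scaleR_diff_right)
      then have "r/2 * dist e w < r/2 * \<delta>" using y by (simp add: algebra_simps)
      then have w: "w \<in> ball e \<delta>" using that by simp
      \<comment> \<open>The cone lemma with \<open>t = 0\<close> shows \<open>x \<in> U\<close>, so
        that membership in \<open>\<Omega>\<close> can be read as
        \<open>\<phi> x < 0\<close>.\<close>
      have x: "x \<in> U" "\<phi> x < 0"
        using cone[of x e 0] that \<delta> eq by auto
      have "y \<in> U \<and> \<phi> y \<le> \<phi> x" unfolding yw by (rule cone) (use that w \<delta> in auto)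
      then have "y \<in> {x\<in>U. \<phi> x < 0}" using x by simp
      then have "y \<in> \<Omega>" unfolding eq[symmetric] by simp
      moreover have "norm w < 2"
        using w e \<delta> norm_triangle_ineq2[of w e] by (auto simp: dist_norm norm_minus_commute)
      then have "dist x y < r" using that by (simp add: yw dist_norm)
      ultimately show "y \<in> \<Omega> \<inter> ball x r" by auto
    qed
    then show ?thesis using \<delta> by (intro exI[of _ "\<delta>/2"] conjI allI impI) (simp, blast)
  qed
  then obtain \<delta> where \<delta>: "\<And>x0. x0 \<in> closure \<Omega> \<Longrightarrow> \<delta> x0 > 0"
    and cs: "\<And>x0 x r. \<lbrakk>x0 \<in> closure \<Omega>; x \<in> \<Omega> \<inter> ball x0 (\<delta> x0); 0 < r; r \<le> \<delta> x0\<rbrakk> \<Longrightarrow>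
       (\<exists>z. ball z (\<delta> x0 * r) \<subseteq> \<Omega> \<inter> ball x r)"
    by metis
  have "compact (closure \<Omega>)" using bd by auto
  then obtain T where T: "T \<subseteq> closure \<Omega>" "finite T" "closure \<Omega> \<subseteq> (\<Union>x0\<in>T. ball x0 (\<delta> x0))"
    by (rule compactE_image[of _ "closure \<Omega>" "\<lambda>x0. ball x0 (\<delta> x0)"]) (use \<delta> in force)+
  define R where "R = Min (insert 1 (\<delta> ` T))"
  have R: "0 < R" "R \<le> 1" "\<And>x0. x0 \<in> T \<Longrightarrow> R \<le> \<delta> x0"
    using T \<delta> unfolding R_def by auto
  show ?thesis
  proof (rule that[of R R])
    fix x r assume x: "x \<in> \<Omega>" and r: "0 < r" "r \<le> R"
    then obtain x0 where x0: "x0 \<in> T" "x \<in> ball x0 (\<delta> x0)"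
      using T(3) closure_subset by blast
    have "r \<le> \<delta> x0" using R(3)[OF x0(1)] r by auto
    then obtain z where "ball z (\<delta> x0 * r) \<subseteq> \<Omega> \<inter> ball x r"
      using cs[of x0 x r] x0 T x r by auto
    moreover have "ball z (R * r) \<subseteq> ball z (\<delta> x0 * r)"
      using R(3)[OF x0(1)] r by (intro subset_ball mult_right_mono) auto
    ultimately show "\<exists>z. ball z (R * r) \<subseteq> \<Omega> \<inter> ball x r" by blast
  qed (use R in auto)
qed

lemma smooth_bounded_domain_measure_density:
  fixes \<Omega> :: "'a::euclidean_space set"
  assumes "smooth_bounded_domain \<Omega>"
  obtains c R where "0 < c" "0 < R" "R \<le> 1"
    "\<And>x r. \<lbrakk>x \<in> \<Omega>; 0 < r; r \<le> R\<rbrakk> \<Longrightarrow> c * r ^ DIM('a) \<le> measure lebesgue (\<Omega> \<inter> ball x r)"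
proof -
  obtain \<eta> R where \<eta>: "0 < \<eta>" "0 < R" "R \<le> 1"
    "\<And>x r. \<lbrakk>x \<in> \<Omega>; 0 < r; r \<le> R\<rbrakk> \<Longrightarrow> \<exists>z. ball z (\<eta> * r) \<subseteq> \<Omega> \<inter> ball x r"
    using smooth_bounded_domain_corkscrew[OF assms] by blast
  have op: "open \<Omega>" using assms by (auto simp: smooth_bounded_domain_def)
  define c where "c = unit_ball_vol (real DIM('a)) * \<eta> ^ DIM('a)"
  show ?thesis
  proof (rule that[of c R])
    fix x r assume x: "x \<in> \<Omega>" and r: "0 < r" "r \<le> R"
    then obtain z where z: "ball z (\<eta> * r) \<subseteq> \<Omega> \<inter> ball x r" using \<eta> by blast
    have "c * r ^ DIM('a) = measure lebesgue (ball z (\<eta> * r))"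
      using \<eta> r by (simp add: c_def content_ball power_mult_distrib)
    also have "\<dots> \<le> measure lebesgue (\<Omega> \<inter> ball x r)"
    proof (rule measure_mono_fmeasurable[OF z])
      show "\<Omega> \<inter> ball x r \<in> lmeasurable"
        using op by (intro lmeasurable_open bounded_Int) auto
    qed auto
    finally show "c * r ^ DIM('a) \<le> measure lebesgue (\<Omega> \<inter> ball x r)" .
  qed (use \<eta> in \<open>auto simp: c_def\<close>)
qed

section \<open>Elementary inequalities\<close>

text \<open>Splitting at \<open>t \<le> \<tau>\<close>. With the threshold left free this takes the
  place of Hoelder's inequality in the averages below, and it applies pointwise to variable
  exponents.\<close>

lemma powr_young:
  fixes t \<tau> q :: real
  assumes "0 \<le> t" "0 < \<tau>" "1 \<le> q"
  shows "t \<le> \<tau> + \<tau> powr (1 - q) * t powr q"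
proof (cases "t \<le> \<tau>")
  case False
  then have t: "t > 0" using assms by auto
  have "t = t powr (1 - q) * t powr q" using t by (simp flip: powr_add)
  also have "\<dots> \<le> \<tau> powr (1 - q) * t powr q"
    using False assms by (intro mult_right_mono powr_mono2') auto
  finally show ?thesis using assms by simp
qed (use assms in \<open>simp add: add_increasing2\<close>)

text \<open>The quotient \<open>a = D / d powr s\<close> satisfies
  \<open>a powr p = d powr n * (D powr p / d powr (n + s * p))\<close>, so its power carries the
  Gagliardo density; \<open>powr_young\<close> with threshold \<open>h\<close> bounds
  \<open>a\<close> itself. As \<open>h \<ge> 1\<close> and \<open>d \<le> \<rho> \<le> 1\<close>,
  the true exponents in the coefficients may be replaced by their lower bounds, while the density
  keeps them.\<close>

lemma difference_le_gagliardo_density: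
  fixes D d \<rho> h :: real
  assumes "0 \<le> D" "0 \<le> d" "d = 0 \<Longrightarrow> D = 0" "d \<le> \<rho>" "0 < \<rho>" "\<rho> \<le> 1" "1 \<le> h"
    and "1 \<le> p0" "p0 \<le> p" "0 \<le> s0" "s0 \<le> s" "0 \<le> n"
  shows "D \<le> \<rho> powr s0 * (h + h powr (1 - p0) * \<rho> powr n * (D powr p / d powr (n + s * p)))"
proof (cases "D = 0")
  case False
  then have D: "D > 0" and d: "d > 0" using assms by (auto simp: less_le)
  define a where "a = D / d powr s"
  have a: "a > 0" using D d by (simp add: a_def)
  have "a \<le> h + h powr (1 - p) * a powr p"
    using a assms by (intro powr_young) auto
  also have "\<dots> \<le> h + h powr (1 - p0) * a powr p"
    using assms by (intro add_left_mono mult_right_mono powr_mono) auto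
  also have "a powr p = d powr n * (D powr p / d powr (n + s * p))"
    using D d by (simp add: a_def powr_divide powr_powr powr_add)
  also have "h powr (1 - p0) * (d powr n * (D powr p / d powr (n + s * p)))
      \<le> h powr (1 - p0) * (\<rho> powr n * (D powr p / d powr (n + s * p)))"
    using d assms by (intro mult_left_mono mult_right_mono powr_mono2) auto
  finally have a_le: "a \<le> h + h powr (1 - p0) * \<rho> powr n * (D powr p / d powr (n + s * p))"
    by (simp add: mult.assoc)
  have "D = d powr s * a" using d by (simp add: a_def)
  also have "d powr s \<le> d powr s0" using d assms by (intro powr_mono') auto
  also have "\<dots> \<le> \<rho> powr s0" using d assms by (intro powr_mono2) auto
  finally have "D \<le> \<rho> powr s0 * a" using a by (simp add: mult_right_mono)
  also have "\<dots> \<le> \<rho> powr s0 * (h + h powr (1 - p0) * \<rho> powr n * (D powr p / d powr (n + s * p)))"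
    using a_le by (intro mult_left_mono) auto
  finally show ?thesis .
qed (use assms in auto)

text \<open>The choice \<open>r = R * h powr (- \<theta>)\<close> with
  \<open>\<theta> = q / (n + s0 * q)\<close> balances the two terms:
  \<open>n * \<theta> / q = 1 - s0 * \<theta>\<close>, so both become multiples of the same power of
  \<open>h\<close>. The factor \<open>R\<close> keeps \<open>r \<le> R\<close> because
  \<open>h \<ge> 1\<close>.\<close>

lemma scale_optimisation:
  fixes A B U h R q s0 n :: real
  assumes "0 < R" "R \<le> 1" "1 \<le> h" "0 < q" "0 < s0" "0 < n" "0 \<le> A" "0 \<le> B"
    and "\<And>r. \<lbrakk>0 < r; r \<le> R\<rbrakk> \<Longrightarrow> U \<le> A * r powr (- n / q) + B * (r powr s0 * h)"
  shows "U \<le> (A * R powr (- n / q) + B) * h powr (n / (n + s0 * q))"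
proof -
  define \<theta> where "\<theta> = q / (n + s0 * q)"
  have pos: "n + s0 * q > 0" using assms by (simp add: add_pos_pos)
  define r where "r = R * h powr (- \<theta>)"
  have \<theta>: "\<theta> > 0" using assms pos by (simp add: \<theta>_def)
  have "h powr (- \<theta>) \<le> 1" using \<theta> assms by (simp add: powr_minus ge_one_powr_ge_zero inverse_le_1_iff)
  then have r: "0 < r" "r \<le> R" using assms by (auto simp: r_def mult_left_le)
  have "r powr (- n / q) = R powr (- n / q) * h powr (- \<theta> * (- n / q))"
    using assms by (simp add: r_def powr_mult powr_powr)
  also have "- \<theta> * (- n / q) = n / (n + s0 * q)"
    using assms pos by (simp add: \<theta>_def)
  finally have 1: "r powr (- n / q) = R powr (- n / q) * h powr (n / (n + s0 * q))" .
  have "r powr s0 * h = R powr s0 * (h powr (- \<theta> * s0) * h powr 1)"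
    using assms by (simp add: r_def powr_mult powr_powr)
  also have "\<dots> = R powr s0 * h powr (- \<theta> * s0 + 1)" by (simp only: powr_add)
  also have "- \<theta> * s0 + 1 = n / (n + s0 * q)"
    using pos by (simp add: \<theta>_def field_simps)
  also have "R powr s0 * h powr (n / (n + s0 * q)) \<le> 1 * h powr (n / (n + s0 * q))"
    using assms by (intro mult_right_mono) (auto simp: powr_le1)
  finally have 2: "r powr s0 * h \<le> h powr (n / (n + s0 * q))" by simp
  have "U \<le> A * r powr (- n / q) + B * (r powr s0 * h)" using assms r by blast
  also have "\<dots> \<le> A * (R powr (- n / q) * h powr (n / (n + s0 * q))) + B * h powr (n / (n + s0 * q))"
    using 1 2 assms by (intro add_mono mult_left_mono) auto
  finally show ?thesis by (simp add: algebra_simps)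
qed

lemma powr_le_one_plus_powr:
  fixes t :: real
  assumes "0 \<le> t" "0 \<le> g" "g \<le> h"
  shows "t powr g \<le> 1 + t powr h"
proof (cases "t \<le> 1")
  case True
  then have "t powr g \<le> 1" using assms by (simp add: powr_le1)
  then show ?thesis by (simp add: add_increasing2)
next
  case False
  then have "t powr g \<le> t powr h" using assms by (intro powr_mono) auto
  then show ?thesis by simp
qed

text \<open>Below \<open>T\<close> the excess power \<open>g - 1\<close> is paid for by a power of
  \<open>T\<close>; above it the additional integrability \<open>\<epsilon>\<close> gives the small
  factor \<open>T powr (- \<epsilon>)\<close>. Both coefficients are independent of
  \<open>g\<close>, so the estimate can be integrated with a variable exponent.\<close>

lemma powr_interpolation:
  fixes t T :: real
  assumes "0 \<le> t" "1 \<le> T" "1 \<le> g" "g \<le> P" "0 < \<epsilon>"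
  shows "t powr g \<le> T powr (P - 1) * t + T powr (- \<epsilon>) * t powr (g + \<epsilon>)"
proof (cases "t \<le> T")
  case True
  have "t powr g = t powr (g - 1) * t"
    using assms by (cases "t = 0") (auto simp flip: powr_mult_base simp: powr_diff)
  also have "t powr (g - 1) \<le> T powr (g - 1)" using True assms by (intro powr_mono2) auto
  also have "T powr (g - 1) \<le> T powr (P - 1)" using assms by (intro powr_mono) auto
  finally have "t powr g \<le> T powr (P - 1) * t" using assms by (simp add: mult_right_mono)
  then show ?thesis by (simp add: add_increasing2)
next
  case False
  then have "t powr g = t powr (- \<epsilon>) * t powr (g + \<epsilon>)" using assms by (simp flip: powr_add)
  also have "t powr (- \<epsilon>) \<le> T powr (- \<epsilon>)" using False assms by (intro powr_mono2') auto
  finally have "t powr g \<le> T powr (- \<epsilon>) * t powr (g + \<epsilon>)" by (simp add: mult_right_mono)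
  then show ?thesis using assms by (simp add: add_increasing)
qed

text \<open>The base \<open>max 1 (2 / b)\<close> is at least \<open>1\<close>, so its exponent may
  be raised to \<open>H\<close>, which makes the constant uniform over a variable exponent.\<close>

lemma powr_quotient_diff_le:
  fixes x y b h H :: real
  assumes "0 < b" "0 \<le> h" "h \<le> H"
  shows "\<bar>(x - y) / b\<bar> powr h \<le> max 1 (2 / b) powr H * (\<bar>x\<bar> powr h + \<bar>y\<bar> powr h)"
proof -
  define m where "m = max \<bar>x\<bar> \<bar>y\<bar>"
  have "\<bar>(x - y) / b\<bar> \<le> 2 / b * m" using assms by (auto simp: m_def abs_divide divide_right_mono max_def)
  also have "\<dots> \<le> max 1 (2 / b) * m" by (intro mult_right_mono) (auto simp: m_def)
  finally have "\<bar>(x - y) / b\<bar> powr h \<le> (max 1 (2 / b) * m) powr h" using assms by (intro powr_mono2) auto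
  also have "\<dots> = max 1 (2 / b) powr h * m powr h" by (simp add: powr_mult m_def)
  also have "\<dots> \<le> max 1 (2 / b) powr H * (\<bar>x\<bar> powr h + \<bar>y\<bar> powr h)"
    using assms by (intro mult_mono powr_mono) (auto simp: m_def max_def)
  finally show ?thesis .
qed

section \<open>Modulars under scaling and the infima that define the norms\<close>

lemma powr_scale_le:
  fixes v t a g :: real
  assumes "0 < a" "1 \<le> t" "1 \<le> g"
  shows "\<bar>v / (t * a)\<bar> powr g \<le> 1 / t * \<bar>v / a\<bar> powr g"
proof -
  have "\<bar>v / (t * a)\<bar> powr g = (1 / t) powr g * \<bar>v / a\<bar> powr g"
    using assms by (subst powr_mult[symmetric]) (auto simp: abs_mult)
  also have "(1 / t) powr g \<le> (1 / t) powr 1" using assms by (intro powr_mono') auto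
  finally show ?thesis using assms by (simp add: mult_right_mono)
qed

text \<open>The scaling hypothesis makes the defining set nonempty and carries the bound from one of
  its elements to every larger number. \<open>P\<close> abstracts the condition
  \<open>\<le> 1\<close> of \<open>lux_norm\<close> and \<open>< 1\<close> of
  \<open>gag_seminorm\<close>.\<close>

lemma Inf_scaling_modular:
  fixes \<rho> :: "real \<Rightarrow> ennreal"
  assumes scale: "\<And>a t. \<lbrakk>0 < a; 1 \<le> t\<rbrakk> \<Longrightarrow> \<rho> (t * a) \<le> ennreal (1 / t) * \<rho> a"
    and fin: "0 < a0" "\<rho> a0 < \<infinity>"
    and P: "\<And>y. P y \<Longrightarrow> y \<le> 1" "\<And>y. y < 1 \<Longrightarrow> P y"
  shows "0 \<le> Inf {a. 0 < a \<and> P (\<rho> a)}" (is "0 \<le> Inf ?S")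
    and "Inf {a. 0 < a \<and> P (\<rho> a)} < b \<Longrightarrow> 0 < b \<and> \<rho> b \<le> 1"
proof -
  obtain y where y: "\<rho> a0 = ennreal y" "0 \<le> y" using fin by (cases "\<rho> a0") auto
  \<comment> \<open>The scaled modular is then at most \<open>y / t\<close>, strictly below
    \<open>1\<close>, where every admissible \<open>P\<close> holds.\<close>
  define t where "t = y + 1"
  have t: "t \<ge> 1" using y by (simp add: t_def)
  have "\<rho> (t * a0) \<le> ennreal (1 / t) * ennreal y" using scale[OF fin(1) t] y by simp
  also have "\<dots> = ennreal (y / t)" using y t by (simp flip: ennreal_mult)
  also have "\<dots> < 1" using y t by (simp add: t_def ennreal_less_iff flip: ennreal_1)
  finally have ne: "?S \<noteq> {}" using P(2) t fin by (intro ex_in_conv[THEN iffD1] exI[of _ "t * a0"]) auto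
  then show "0 \<le> Inf ?S" by (intro cInf_greatest) auto
  assume "Inf ?S < b"
  then obtain a where a: "a \<in> ?S" "a < b" using cInf_lessD[OF ne] by blast
  then have "\<rho> (b / a * a) \<le> ennreal (1 / (b / a)) * \<rho> a" by (intro scale) auto
  also have "\<dots> \<le> ennreal 1 * 1" using a P(1) by (intro mult_mono ennreal_leI) auto
  finally show "0 < b \<and> \<rho> b \<le> 1" using a by auto
qed

section \<open>Fatou bounds and \<open>L\<^sup>1\<close> limits\<close>

text \<open>Fatou's lemma, with an eventual bound because the Cauchy estimate below holds only from
  some index on.\<close>

lemma nn_integral_le_of_AE_limit:
  fixes g :: "nat \<Rightarrow> 'a \<Rightarrow> ennreal"
  assumes [measurable]: "\<And>j. g j \<in> borel_measurable M"
    and lim: "AE x in M. (\<lambda>j. g j x) \<longlonglongrightarrow> w x"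
    and bd: "\<forall>\<^sub>F j in sequentially. (\<integral>\<^sup>+ x. g j x \<partial>M) \<le> C"
  shows "(\<integral>\<^sup>+ x. w x \<partial>M) \<le> C"
proof -
  have "AE x in M. w x = liminf (\<lambda>j. g j x)"
    using lim by eventually_elim (simp add: lim_imp_Liminf)
  then have "(\<integral>\<^sup>+ x. w x \<partial>M) = (\<integral>\<^sup>+ x. liminf (\<lambda>j. g j x) \<partial>M)"
    by (rule nn_integral_cong_AE)
  also have "\<dots> \<le> liminf (\<lambda>j. \<integral>\<^sup>+ x. g j x \<partial>M)"
    by (rule nn_integral_liminf) measurable
  also have "\<dots> \<le> limsup (\<lambda>j. \<integral>\<^sup>+ x. g j x \<partial>M)" by (rule Liminf_le_Limsup) simp
  also have "\<dots> \<le> C" by (rule Limsup_bounded[OF bd])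
  finally show ?thesis .
qed

text \<open>The Riesz-Fischer argument: increments of size \<open>(1/2) ^ k\<close> in
  \<open>L\<^sup>1\<close> are absolutely summable almost everywhere, and Fatou turns the pointwise
  limit into a limit in \<open>L\<^sup>1\<close>.\<close>

lemma L1_Cauchy_imp_subseq_limit:
  fixes f :: "nat \<Rightarrow> 'a \<Rightarrow> real"
  assumes [measurable]: "\<And>k. f k \<in> borel_measurable M"
    and Cauchy: "\<And>\<epsilon>. \<epsilon> > 0 \<Longrightarrow> \<exists>k0. \<forall>j\<ge>k0. \<forall>k\<ge>k0. (\<integral>\<^sup>+ x. ennreal \<bar>f j x - f k x\<bar> \<partial>M) \<le> ennreal \<epsilon>"
  obtains r v where "strict_mono (r :: nat \<Rightarrow> nat)" "v \<in> borel_measurable M"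
    "AE x in M. (\<lambda>k. f (r k) x) \<longlonglongrightarrow> v x"
    "(\<lambda>k. \<integral>\<^sup>+ x. ennreal \<bar>f (r k) x - v x\<bar> \<partial>M) \<longlonglongrightarrow> 0"
proof -
  have "\<exists>k0. \<forall>j\<ge>k0. \<forall>k\<ge>k0. (\<integral>\<^sup>+ x. ennreal \<bar>f j x - f k x\<bar> \<partial>M) \<le> ennreal ((1/2) ^ i)" for i :: nat
    by (rule Cauchy) simp
  then obtain N where N: "\<And>i j k. \<lbrakk>j \<ge> N i; k \<ge> N i\<rbrakk> \<Longrightarrow> (\<integral>\<^sup>+ x. ennreal \<bar>f j x - f k x\<bar> \<partial>M) \<le> ennreal ((1/2) ^ i)"
    by metis
  \<comment> \<open>The sum dominates \<open>N k\<close> without monotonicity of \<open>N\<close>;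
    the summand \<open>k\<close> gives strict growth.\<close>
  define r where "r = (\<lambda>k. k + (\<Sum>i\<le>k. N i))"
  have r: "strict_mono r" by (rule strict_monoI_Suc) (simp add: r_def)
  have rN: "N k \<le> r k" for k
  proof -
    have "N k \<le> (\<Sum>i\<le>k. N i)" by (intro member_le_sum) auto
    then show ?thesis by (simp add: r_def)
  qed
  let ?d = "\<lambda>k x. f (r (Suc k)) x - f (r k) x"
  have step: "(\<integral>\<^sup>+ x. ennreal \<bar>?d k x\<bar> \<partial>M) \<le> ennreal ((1/2) ^ k)" for k
    by (rule N) (use rN[of k] r[THEN strict_monoD, of k "Suc k"] in auto)
  have "(\<integral>\<^sup>+ x. (\<Sum>k. ennreal \<bar>?d k x\<bar>) \<partial>M) = (\<Sum>k. \<integral>\<^sup>+ x. ennreal \<bar>?d k x\<bar> \<partial>M)"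
    by (rule nn_integral_suminf) measurable
  also have "\<dots> \<le> (\<Sum>k. ennreal ((1/2) ^ k))" by (intro suminf_le step) auto
  also have "\<dots> = ennreal (\<Sum>k. (1/2) ^ k)" by (rule suminf_ennreal2) (auto intro: summable_geometric)
  finally have "(\<integral>\<^sup>+ x. (\<Sum>k. ennreal \<bar>?d k x\<bar>) \<partial>M) \<noteq> \<infinity>" by (auto simp: top_unique)
  then have "AE x in M. (\<Sum>k. ennreal \<bar>?d k x\<bar>) \<noteq> \<infinity>"
    by (intro nn_integral_PInf_AE) auto
  then have conv: "AE x in M. convergent (\<lambda>k. f (r k) x)"
  proof (rule AE_mp, intro AE_I2 impI)
    fix x assume "(\<Sum>k. ennreal \<bar>?d k x\<bar>) \<noteq> \<infinity>"
    then have "summable (\<lambda>k. \<bar>?d k x\<bar>)" by (intro summable_suminf_not_top) auto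
    then have "summable (\<lambda>k. ?d k x)" by (rule summable_rabs_cancel)
    then have "convergent (\<lambda>k. \<Sum>i<k. ?d i x)" by (simp add: summable_iff_convergent)
    moreover have "(\<Sum>i<k. ?d i x) = f (r k) x - f (r 0) x" for k
      by (rule sum_lessThan_telescope)
    ultimately have "convergent (\<lambda>k. f (r k) x - f (r 0) x)" by simp
    then show "convergent (\<lambda>k. f (r k) x)"
      using convergent_add[OF _ convergent_const, of "\<lambda>k. f (r k) x - f (r 0) x" "f (r 0) x"] by simp
  qed
  \<comment> \<open>Where the sequence diverges \<open>lim\<close> has an unspecified value, but
    this happens only on a null set.\<close>
  define v where "v = (\<lambda>x. lim (\<lambda>k. f (r k) x))"
  have [measurable]: "v \<in> borel_measurable M"
    unfolding v_def by (rule borel_measurable_lim_metric) measurable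
  have AEv: "AE x in M. (\<lambda>k. f (r k) x) \<longlonglongrightarrow> v x"
    using conv by eventually_elim (simp add: v_def convergent_LIMSEQ_iff)
  have "(\<lambda>k. \<integral>\<^sup>+ x. ennreal \<bar>f (r k) x - v x\<bar> \<partial>M) \<longlonglongrightarrow> 0"
  proof (rule tendsto_sandwich[OF always_eventually always_eventually tendsto_const])
    have "(\<lambda>k. ennreal ((1/2) ^ k)) \<longlonglongrightarrow> ennreal 0"
      by (intro tendsto_ennrealI LIMSEQ_power_zero) auto
    then show "(\<lambda>k. ennreal ((1/2) ^ k)) \<longlonglongrightarrow> 0" by simp
    show "\<forall>k. (\<integral>\<^sup>+ x. ennreal \<bar>f (r k) x - v x\<bar> \<partial>M) \<le> ennreal ((1/2) ^ k)"
    proof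
      fix k
      show "(\<integral>\<^sup>+ x. ennreal \<bar>f (r k) x - v x\<bar> \<partial>M) \<le> ennreal ((1/2) ^ k)"
      proof (rule nn_integral_le_of_AE_limit[where g = "\<lambda>j x. ennreal \<bar>f (r k) x - f (r j) x\<bar>"])
        show "AE x in M. (\<lambda>j. ennreal \<bar>f (r k) x - f (r j) x\<bar>) \<longlonglongrightarrow> ennreal \<bar>f (r k) x - v x\<bar>"
          using AEv by eventually_elim (intro tendsto_intros tendsto_ennrealI)
        show "\<forall>\<^sub>F j in sequentially. (\<integral>\<^sup>+ x. ennreal \<bar>f (r k) x - f (r j) x\<bar> \<partial>M) \<le> ennreal ((1/2) ^ k)"
          using eventually_ge_at_top[of k]
        proof eventually_elim
          case (elim j)
          then have "r k \<le> r j" using r by (simp add: strict_mono_less_eq)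
          then show ?case using rN[of k] by (intro N) auto
        qed
      qed measurable
    qed
  qed auto
  then show ?thesis using that[OF r _ AEv] by simp
qed

section \<open>Pointwise control by averaging\<close>

text \<open>The geometry of the boundary enters through \<open>density\<close>, stated with
  \<open>powr\<close> so that it combines with real exponents. The lower bound
  \<open>\<sigma>\<close> is global, for the compactness argument; the bootstrap works with local
  lower bounds of \<open>s\<close> and \<open>p\<close>.\<close>

locale fractional_domain =
  fixes \<Omega> :: "'a::euclidean_space set" and s p :: "'a \<Rightarrow> 'a \<Rightarrow> real" and \<sigma> c R :: real
  assumes open_dom: "open \<Omega>" and bounded_dom: "bounded \<Omega>"
    and cont_s: "continuous_on UNIV (\<lambda>(x, y). s x y)"
    and cont_p: "continuous_on UNIV (\<lambda>(x, y). p x y)"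
    and sigma: "0 < \<sigma>" "\<And>x y. \<sigma> \<le> s x y"
    and p_gt_1: "\<And>x y. 1 < p x y"
    and subcritical: "\<And>x y. s x y * p x y < real DIM('a)"
    and cR: "0 < c" "0 < R" "R \<le> 1"
    and density: "\<And>x r. \<lbrakk>x \<in> \<Omega>; 0 < r; r \<le> R\<rbrakk> \<Longrightarrow>
      c * r powr real DIM('a) \<le> measure lebesgue (\<Omega> \<inter> ball x r)"
begin

abbreviation L :: "'a measure" where "L \<equiv> lebesgue_on \<Omega>"

definition energy :: "('a \<Rightarrow> real) \<Rightarrow> 'a \<Rightarrow> ennreal" where
  "energy u x = (\<integral>\<^sup>+ y. ennreal (\<bar>u x - u y\<bar> powr p x y / norm (x - y) powr (real DIM('a) + s x y * p x y)) \<partial>L)"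

text \<open>The normalised class: \<open>u / a\<close> belongs to it, with one fixed
  \<open>M\<close>, whenever \<open>a\<close> exceeds the norm of \<open>u\<close> (see
  \<open>Wspace_normalised\<close>). The \<open>L\<^sup>1\<close> bound starts the
  bootstrap.\<close>

definition controlled :: "real \<Rightarrow> ('a \<Rightarrow> real) \<Rightarrow> bool" where
  "controlled M u \<longleftrightarrow> u \<in> borel_measurable L \<and> (\<integral>\<^sup>+ x. ennreal \<bar>u x\<bar> \<partial>L) \<le> ennreal M \<and>
     (\<integral>\<^sup>+ x. energy u x \<partial>L) \<le> 1"

section \<open>Measurability over \<open>\<Omega>\<close>, and the modulars as integrals over
  \<open>L\<close>\<close>

lemma lmeasurable_dom: "\<Omega> \<in> lmeasurable"
  using open_dom bounded_dom by (simp add: lmeasurable_open)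

lemma space_L [simp]: "space L = \<Omega>"
  using lmeasurable_dom by (simp add: space_restrict_space)

sublocale finite_measure L
  by (rule finite_measure_lebesgue_on[OF lmeasurable_dom])

lemma ident_measurable_L [measurable]: "(\<lambda>x. x) \<in> borel_measurable L"
  by (intro measurable_restrict_space1 measurable_completion) simp

lemma sets_L_ball [measurable]: "\<Omega> \<inter> ball x r \<in> sets L"
  using open_dom by (auto simp: sets_restrict_space)

lemma indicator_ball_measurable [measurable]:
  "(indicator (ball x r) :: 'a \<Rightarrow> ennreal) \<in> borel_measurable L"
  by (intro measurable_restrict_space1 measurable_completion)
    (simp add: borel_measurable_indicator)

lemma set_borel_measurable_iff:
  fixes u :: "'a \<Rightarrow> real"
  shows "set_borel_measurable lebesgue \<Omega> u \<longleftrightarrow> u \<in> borel_measurable L"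
  using borel_measurable_restrict_space_iff[of \<Omega> lebesgue u] fmeasurableD[OF lmeasurable_dom]
  by (simp add: set_borel_measurable_def)

lemma continuous_exponent_measurable:
  fixes g :: "'a \<Rightarrow> real"
  assumes "continuous_on (closure \<Omega>) g"
  shows "g \<in> borel_measurable L"
  using continuous_on_subset[OF assms closure_subset] lmeasurable_dom
  by (simp add: continuous_imp_measurable_on_sets_lebesgue fmeasurableD)

text \<open>Continuity gives Borel measurability on pairs; composing with the projections, which are
  measurable into Borel sets, transfers it to the product of \<open>L\<close> with itself.\<close>

lemma pair_measurable_L [measurable]:
  assumes "continuous_on UNIV (\<lambda>(x, y). f x y)"
  shows "(\<lambda>z. f (fst z) (snd z) :: real) \<in> borel_measurable (L \<Otimes>\<^sub>M L)"
proof -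
  have "(\<lambda>z. (fst z, snd z)) \<in> L \<Otimes>\<^sub>M L \<rightarrow>\<^sub>M (borel \<Otimes>\<^sub>M borel :: ('a \<times> 'a) measure)"
    by measurable
  then have "(\<lambda>z. (fst z, snd z)) \<in> L \<Otimes>\<^sub>M L \<rightarrow>\<^sub>M (borel :: ('a \<times> 'a) measure)"
    by (simp add: borel_prod)
  from measurable_compose[OF this borel_measurable_continuous_onI[OF assms]]
  show ?thesis by simp
qed

lemma section_measurable_L:
  assumes "continuous_on UNIV (\<lambda>(x, y). f x y)" "x \<in> \<Omega>"
  shows "(\<lambda>y. f x y :: real) \<in> borel_measurable L"
proof -
  have "(\<lambda>y. (x, y)) \<in> L \<rightarrow>\<^sub>M L \<Otimes>\<^sub>M L" using assms(2) by simp
  from measurable_compose[OF this pair_measurable_L[OF assms(1)]] show ?thesis by simp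
qed

lemma energy_measurable [measurable]:
  assumes [measurable]: "u \<in> borel_measurable L"
  shows "energy u \<in> borel_measurable L"
proof -
  note [measurable] = pair_measurable_L[OF cont_s] pair_measurable_L[OF cont_p]
  have "(\<lambda>x. \<integral>\<^sup>+ y. ennreal (\<bar>u x - u y\<bar> powr p x y / norm (x - y) powr (real DIM('a) + s x y * p x y)) \<partial>L)
      \<in> borel_measurable L"
    by (rule borel_measurable_nn_integral) (simp add: case_prod_unfold)
  then show ?thesis by (simp add: energy_def[abs_def])
qed

lemma gag_modular_eq: "gag_modular \<Omega> s p u = (\<integral>\<^sup>+ x. energy u x \<partial>L)"
  using lmeasurable_dom
  by (simp add: gag_modular_def energy_def nn_integral_restrict_space fmeasurableD)

lemma var_modular_eq: "var_modular \<Omega> g u = (\<integral>\<^sup>+ x. ennreal (\<bar>u x\<bar> powr g x) \<partial>L)"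
  using lmeasurable_dom
  by (simp add: var_modular_def nn_integral_restrict_space fmeasurableD)

section \<open>Averages over balls, the pointwise bound and the gain of integrability\<close>

lemma density_L:
  assumes "x \<in> \<Omega>" "0 < r" "r \<le> R"
  shows "c * r powr real DIM('a) \<le> measure L (\<Omega> \<inter> ball x r)"
  using density[OF assms] lmeasurable_dom by (simp add: measure_restrict_space fmeasurableD)

text \<open>This is \<open>difference_le_gagliardo_density\<close> integrated over \<open>A\<close>,
  with the integral of the density enlarged from \<open>A\<close> to all of \<open>\<Omega>\<close>.
  The parameter \<open>h\<close> stays free: the pointwise bound takes a power of
  \<open>1 + enn2real (energy u x)\<close>, the compactness argument takes \<open>1\<close>.\<close>

lemma nn_integral_difference_le:
  assumes [measurable]: "u \<in> borel_measurable L" and x: "x \<in> \<Omega>" and fin: "energy u x \<noteq> \<infinity>"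
    and A [measurable]: "A \<in> sets L" "A \<subseteq> cball x \<rho>"
    and \<rho>: "0 < \<rho>" "\<rho> \<le> 1" and h: "1 \<le> h"
    and lower: "1 \<le> p0" "0 \<le> s0" "\<And>y. y \<in> A \<Longrightarrow> p0 \<le> p x y \<and> s0 \<le> s x y"
  shows "(\<integral>\<^sup>+ y\<in>A. ennreal \<bar>u x - u y\<bar> \<partial>L) \<le>
    ennreal (\<rho> powr s0 * (h * measure L A + h powr (1 - p0) * \<rho> powr real DIM('a) * enn2real (energy u x)))"
proof -
  let ?G = "\<lambda>y. \<bar>u x - u y\<bar> powr p x y / norm (x - y) powr (real DIM('a) + s x y * p x y)"
  let ?a = "\<rho> powr s0 * h" and ?b = "\<rho> powr s0 * h powr (1 - p0) * \<rho> powr real DIM('a)"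
  have [measurable]: "(\<lambda>y. p x y) \<in> borel_measurable L" "(\<lambda>y. s x y) \<in> borel_measurable L"
    by (rule section_measurable_L[OF cont_p x] section_measurable_L[OF cont_s x])+
  have "(\<integral>\<^sup>+ y\<in>A. ennreal \<bar>u x - u y\<bar> \<partial>L) \<le>
      (\<integral>\<^sup>+ y. ennreal ?a * indicator A y + ennreal ?b * ennreal (?G y) \<partial>L)"
  proof (rule nn_integral_mono)
    fix y
    show "ennreal \<bar>u x - u y\<bar> * indicator A y \<le> ennreal ?a * indicator A y + ennreal ?b * ennreal (?G y)"
    proof (cases "y \<in> A")
      case True
      then have "\<bar>u x - u y\<bar> \<le> \<rho> powr s0 * (h + h powr (1 - p0) * \<rho> powr real DIM('a) * ?G y)"
        using A \<rho> h lower by (intro difference_le_gagliardo_density) (auto simp: dist_norm)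
      then have "\<bar>u x - u y\<bar> \<le> ?a + ?b * ?G y" by (simp add: algebra_simps)
      then show ?thesis
        using True h \<rho> by (simp add: ennreal_leI flip: ennreal_mult ennreal_plus)
    qed auto
  qed
  also have "\<dots> = ennreal ?a * emeasure L A + ennreal ?b * energy u x"
    unfolding energy_def by (simp add: nn_integral_add nn_integral_cmult)
  also have "\<dots> = ennreal ?a * ennreal (measure L A) + ennreal ?b * ennreal (enn2real (energy u x))"
    using fin by (simp add: emeasure_eq_measure less_top)
  also have "\<dots> = ennreal (?a * measure L A + ?b * enn2real (energy u x))"
    using h by (simp flip: ennreal_mult ennreal_plus)
  finally show ?thesis by (simp add: algebra_simps)
qed

text \<open>Average \<open>|u x| \<le> |u y| + |u x - u y|\<close> over
  \<open>y \<in> \<Omega> \<inter> ball x r\<close>: the first term is controlled by the local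
  \<open>L\<^sup>q\<close> bound, the second by the energy. Measure density bounds
  \<open>r powr real DIM('a)\<close> by a multiple of the measure \<open>m\<close> of this set, so
  \<open>m\<close> cancels.\<close>

lemma pointwise_bound:
  assumes [measurable]: "u \<in> borel_measurable L" and x: "x \<in> \<Omega>" and fin: "energy u x \<noteq> \<infinity>"
    and r: "0 < r" "r \<le> R" and q: "1 \<le> q" and M: "0 \<le> M"
    and lower: "1 \<le> p0" "0 \<le> s0" "\<And>y. y \<in> ball x r \<Longrightarrow> p0 \<le> p x y \<and> s0 \<le> s x y"
    and bound: "(\<integral>\<^sup>+ y\<in>ball x r. ennreal (\<bar>u y\<bar> powr q) \<partial>L) \<le> ennreal M"
  shows "\<bar>u x\<bar> \<le> (1 + M / c) * r powr (- real DIM('a) / q)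
    + (1 + 1 / c) * (r powr s0 * (1 + enn2real (energy u x)) powr (1 / p0))"
proof -
  let ?n = "real DIM('a)"
  define A where "A = \<Omega> \<inter> ball x r"
  have A [measurable]: "A \<in> sets L" unfolding A_def by (rule sets_L_ball)
  define m where "m = measure L A"
  define g where "g = enn2real (energy u x)"
  \<comment> \<open>This \<open>h\<close> satisfies \<open>g \<le> h powr p0\<close>, hence
    \<open>h powr (1 - p0) * g \<le> h\<close>: both contributions to the averaged difference have
    the order of \<open>h\<close>.\<close>
  define h where "h = (1 + g) powr (1 / p0)"
  \<comment> \<open>With this threshold \<open>\<tau> powr (1 - q) = \<tau> * r powr ?n\<close>, so
    both terms produced by \<open>powr_young\<close> are of order \<open>\<tau> * m\<close>.\<close>
  define \<tau> where "\<tau> = r powr (- ?n / q)"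
  have g: "g \<ge> 0" by (simp add: g_def)
  have \<tau>: "\<tau> > 0" using r by (simp add: \<tau>_def)
  have h: "h \<ge> 1" using g lower by (simp add: h_def ge_one_powr_ge_zero)
  have rn: "r powr ?n \<le> m / c"
    using density_L[OF x r] cR by (simp add: A_def m_def field_simps)
  have "0 < r powr ?n" using r by simp
  then have m: "m > 0" using rn cR by (smt (verit) divide_nonpos_pos)
  have 1: "(\<integral>\<^sup>+ y\<in>A. ennreal \<bar>u y\<bar> \<partial>L) \<le> ennreal (\<tau> * m + \<tau> powr (1 - q) * M)"
  proof -
    have "(\<integral>\<^sup>+ y\<in>A. ennreal \<bar>u y\<bar> \<partial>L) \<le>
      (\<integral>\<^sup>+ y. ennreal \<tau> * indicator A y + ennreal (\<tau> powr (1 - q)) * (ennreal (\<bar>u y\<bar> powr q) * indicator (ball x r) y) \<partial>L)"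
    proof (rule nn_integral_mono)
      fix y
      have "\<bar>u y\<bar> \<le> \<tau> + \<tau> powr (1 - q) * \<bar>u y\<bar> powr q"
        using \<tau> q by (intro powr_young) auto
      then have "ennreal \<bar>u y\<bar> \<le> ennreal \<tau> + ennreal (\<tau> powr (1 - q)) * ennreal (\<bar>u y\<bar> powr q)"
        using \<tau> by (simp add: ennreal_leI flip: ennreal_mult ennreal_plus)
      then show "ennreal \<bar>u y\<bar> * indicator A y \<le> ennreal \<tau> * indicator A y
          + ennreal (\<tau> powr (1 - q)) * (ennreal (\<bar>u y\<bar> powr q) * indicator (ball x r) y)"
        by (auto simp: indicator_def A_def)
    qed
    also have "\<dots> = ennreal \<tau> * emeasure L A
        + ennreal (\<tau> powr (1 - q)) * (\<integral>\<^sup>+ y\<in>ball x r. ennreal (\<bar>u y\<bar> powr q) \<partial>L)"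
      by (subst nn_integral_add, simp, simp)
        (subst nn_integral_cmult, simp, subst nn_integral_cmult_indicator, simp_all)
    also have "\<dots> \<le> ennreal \<tau> * ennreal m + ennreal (\<tau> powr (1 - q)) * ennreal M"
      using bound by (intro add_mono mult_left_mono) (auto simp: emeasure_eq_measure m_def)
    also have "\<dots> = ennreal (\<tau> * m + \<tau> powr (1 - q) * M)"
      using \<tau> M m by (simp flip: ennreal_mult ennreal_plus)
    finally show ?thesis .
  qed
  have 2: "(\<integral>\<^sup>+ y\<in>A. ennreal \<bar>u x - u y\<bar> \<partial>L) \<le>
      ennreal (r powr s0 * (h * m + h powr (1 - p0) * r powr ?n * g))"
    unfolding m_def g_def
    by (rule nn_integral_difference_le) (use x fin r cR h lower A in \<open>auto simp: A_def\<close>)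
  have "ennreal (\<bar>u x\<bar> * m) = (\<integral>\<^sup>+ y\<in>A. ennreal \<bar>u x\<bar> \<partial>L)"
    using m by (simp add: nn_integral_cmult_indicator emeasure_eq_measure m_def ennreal_mult)
  also have "\<dots> \<le> (\<integral>\<^sup>+ y. ennreal \<bar>u y\<bar> * indicator A y + ennreal \<bar>u x - u y\<bar> * indicator A y \<partial>L)"
    by (rule nn_integral_mono) (auto simp: indicator_def simp flip: ennreal_plus intro!: ennreal_leI)
  also have "\<dots> = (\<integral>\<^sup>+ y\<in>A. ennreal \<bar>u y\<bar> \<partial>L) + (\<integral>\<^sup>+ y\<in>A. ennreal \<bar>u x - u y\<bar> \<partial>L)"
    by (rule nn_integral_add) auto
  also have "\<dots> \<le> ennreal (\<tau> * m + \<tau> powr (1 - q) * M)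
      + ennreal (r powr s0 * (h * m + h powr (1 - p0) * r powr ?n * g))"
    by (rule add_mono[OF 1 2])
  also have "\<dots> = ennreal (\<tau> * m + \<tau> powr (1 - q) * M + r powr s0 * (h * m + h powr (1 - p0) * r powr ?n * g))"
    using \<tau> M m h g by (simp flip: ennreal_plus)
  finally have "\<bar>u x\<bar> * m \<le> \<tau> * m + \<tau> powr (1 - q) * M + r powr s0 * (h * m + h powr (1 - p0) * r powr ?n * g)"
    using \<tau> M m h g by (subst (asm) ennreal_le_iff) auto
  also have "\<tau> powr (1 - q) = \<tau> * r powr ?n"
  proof -
    have "- ?n / q * (1 - q) = - ?n / q + ?n" using q by (simp add: field_simps)
    then show ?thesis using r unfolding \<tau>_def by (simp only: powr_powr powr_add)
  qed
  also have "\<tau> * r powr ?n * M \<le> \<tau> * (m / c) * M"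
    using rn \<tau> M by (intro mult_right_mono mult_left_mono) auto
  also have "h powr (1 - p0) * r powr ?n * g \<le> (m / c) * h"
  proof -
    have "h powr (1 - p0) * g \<le> h powr (1 - p0) * h powr p0"
      using g lower by (intro mult_left_mono) (auto simp: h_def powr_powr)
    also have "\<dots> = h" using h by (simp flip: powr_add)
    finally have "r powr ?n * (h powr (1 - p0) * g) \<le> (m / c) * h"
      using rn g h m cR by (intro mult_mono) auto
    then show ?thesis by (simp add: algebra_simps)
  qed
  finally have "\<bar>u x\<bar> * m \<le> \<tau> * m + \<tau> * (m / c) * M + r powr s0 * (h * m + (m / c) * h)"
    by (simp add: mult_left_mono)
  also have "\<dots> = ((1 + M / c) * \<tau> + (1 + 1 / c) * (r powr s0 * h)) * m"
    by (simp add: algebra_simps)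
  finally show ?thesis using m by (simp add: \<tau>_def h_def g_def)
qed

text \<open>Optimising \<open>pointwise_bound\<close> over the radius bounds \<open>|u x|\<close> by
  a multiple of a power of \<open>1 + energy u x\<close>. The new exponent is the one that raises
  this power to exponent \<open>1\<close>, and the energy has integral at most
  \<open>1\<close>.\<close>

lemma integrability_improvement:
  assumes lower: "1 \<le> p0" "0 < s0" "\<And>x y. \<lbrakk>x \<in> ball x0 \<rho>1; y \<in> ball x0 \<rho>1\<rbrakk> \<Longrightarrow> p0 \<le> p x y \<and> s0 \<le> s x y"
    and \<rho>: "\<rho>2 < \<rho>1" and q: "1 \<le> q" and M: "0 \<le> M"
  obtains M' where "0 \<le> M'"
    "\<And>u. \<lbrakk>u \<in> borel_measurable L; (\<integral>\<^sup>+ x. energy u x \<partial>L) \<le> 1;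
       (\<integral>\<^sup>+ y\<in>ball x0 \<rho>1. ennreal (\<bar>u y\<bar> powr q) \<partial>L) \<le> ennreal M\<rbrakk> \<Longrightarrow>
       (\<integral>\<^sup>+ y\<in>ball x0 \<rho>2. ennreal (\<bar>u y\<bar> powr (p0 + s0 * p0 / real DIM('a) * q)) \<partial>L) \<le> ennreal M'"
proof -
  let ?n = "real DIM('a)"
  \<comment> \<open>Radii up to \<open>\<rho>1 - \<rho>2\<close> keep the averaging balls inside
    \<open>ball x0 \<rho>1\<close>, where the exponent bounds and the integral bound on
    \<open>u\<close> hold.\<close>
  define R' where "R' = min R (\<rho>1 - \<rho>2)"
  have R': "0 < R'" "R' \<le> 1" "R' \<le> R" using cR \<rho> by (auto simp: R'_def)
  define K where "K = (1 + M / c) * R' powr (- ?n / q) + (1 + 1 / c)"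
  have K: "K \<ge> 0" using M cR unfolding K_def by (intro add_nonneg_nonneg mult_nonneg_nonneg) auto
  define q' where "q' = p0 + s0 * p0 / ?n * q"
  have q': "q' \<ge> 0" using lower q by (auto simp: q'_def)
  define M' where "M' = K powr q' * (measure L \<Omega> + 1)"
  show ?thesis
  proof (rule that[of M'])
    show "0 \<le> M'" by (simp add: M'_def)
    fix u assume [measurable]: "u \<in> borel_measurable L" and en: "(\<integral>\<^sup>+ x. energy u x \<partial>L) \<le> 1"
      and bd: "(\<integral>\<^sup>+ y\<in>ball x0 \<rho>1. ennreal (\<bar>u y\<bar> powr q) \<partial>L) \<le> ennreal M"
    have "AE x in L. energy u x \<noteq> \<infinity>"
      using en by (intro nn_integral_PInf_AE) (auto simp: top_unique)
    then have "AE x in L. ennreal (\<bar>u x\<bar> powr q') * indicator (ball x0 \<rho>2) x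
        \<le> ennreal (K powr q') * (1 + energy u x)"
    proof (rule AE_mp, intro AE_I2 impI)
      fix x assume "x \<in> space L" and fin: "energy u x \<noteq> \<infinity>"
      then have x: "x \<in> \<Omega>" by simp
      define g where "g = enn2real (energy u x)"
      have g: "g \<ge> 0" "energy u x = ennreal g" using fin by (auto simp: g_def less_top)
      show "ennreal (\<bar>u x\<bar> powr q') * indicator (ball x0 \<rho>2) x \<le> ennreal (K powr q') * (1 + energy u x)"
      proof (cases "x \<in> ball x0 \<rho>2")
        case True
        have sub: "ball x r \<subseteq> ball x0 \<rho>1" if "r \<le> R'" for r
        proof
          fix y assume "y \<in> ball x r"
          then show "y \<in> ball x0 \<rho>1"
            using True that dist_triangle[of x0 y x] by (auto simp: R'_def)
        qed
        have "\<bar>u x\<bar> \<le> K * ((1 + g) powr (1 / p0)) powr (?n / (?n + s0 * q))"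
          unfolding K_def
        proof (rule scale_optimisation)
          fix r assume r: "0 < r" "r \<le> R'"
          show "\<bar>u x\<bar> \<le> (1 + M / c) * r powr (- ?n / q) + (1 + 1 / c) * (r powr s0 * (1 + g) powr (1 / p0))"
            unfolding g_def
          proof (rule pointwise_bound)
            have "(\<integral>\<^sup>+ y\<in>ball x r. ennreal (\<bar>u y\<bar> powr q) \<partial>L) \<le> (\<integral>\<^sup>+ y\<in>ball x0 \<rho>1. ennreal (\<bar>u y\<bar> powr q) \<partial>L)"
              using sub[OF r(2)] by (intro nn_integral_mono mult_left_mono) (auto simp: indicator_def)
            then show "(\<integral>\<^sup>+ y\<in>ball x r. ennreal (\<bar>u y\<bar> powr q) \<partial>L) \<le> ennreal M" using bd by simp
            show "p0 \<le> p x y \<and> s0 \<le> s x y" if "y \<in> ball x r" for y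
              using lower(3)[of x y] sub[OF r(2)] that r(1) centre_in_ball by blast
          qed (use x fin r R' q M lower in auto)
        qed (use R' g lower q M cR in \<open>auto intro!: ge_one_powr_ge_zero\<close>)
        then have "\<bar>u x\<bar> powr q' \<le> (K * ((1 + g) powr (1 / p0)) powr (?n / (?n + s0 * q))) powr q'"
          using q' by (intro powr_mono2) auto
        also have "\<dots> = K powr q' * (1 + g) powr (1 / p0 * (?n / (?n + s0 * q)) * q')"
          using K g by (simp add: powr_mult powr_powr mult.assoc)
        also have "1 / p0 * (?n / (?n + s0 * q)) * q' = 1"
        proof -
          have "?n + s0 * q > 0" using lower q by (simp add: add_pos_pos)
          moreover have "q' = p0 * (?n + s0 * q) / ?n" by (simp add: q'_def field_simps)
          ultimately show ?thesis using lower by simp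
        qed
        finally have "\<bar>u x\<bar> powr q' \<le> K powr q' * (1 + g)" using g by simp
        then have "ennreal (\<bar>u x\<bar> powr q') \<le> ennreal (K powr q') * (1 + ennreal g)"
          using g by (simp add: ennreal_leI flip: ennreal_mult ennreal_plus ennreal_1)
        then show ?thesis using True g by simp
      qed auto
    qed
    then have "(\<integral>\<^sup>+ y\<in>ball x0 \<rho>2. ennreal (\<bar>u y\<bar> powr q') \<partial>L) \<le> (\<integral>\<^sup>+ x. ennreal (K powr q') * (1 + energy u x) \<partial>L)"
      by (rule nn_integral_mono_AE)
    also have "\<dots> = ennreal (K powr q') * (emeasure L \<Omega> + (\<integral>\<^sup>+ x. energy u x \<partial>L))"
      by (simp add: nn_integral_cmult nn_integral_add)
    also have "\<dots> \<le> ennreal (K powr q') * (ennreal (measure L \<Omega>) + 1)"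
      using en by (intro mult_left_mono add_mono) (auto simp: emeasure_eq_measure)
    also have "\<dots> = ennreal M'"
      by (simp add: M'_def flip: ennreal_mult ennreal_plus ennreal_1)
    finally show "(\<integral>\<^sup>+ y\<in>ball x0 \<rho>2. ennreal (\<bar>u y\<bar> powr (p0 + s0 * p0 / ?n * q)) \<partial>L) \<le> ennreal M'"
      by (simp add: q'_def)
  qed
qed

end

section \<open>Bootstrapping to subcritical exponents\<close>

lemma continuous_pair_lower_bound:
  fixes f :: "'a::metric_space \<Rightarrow> 'a \<Rightarrow> real"
  assumes "continuous_on UNIV (\<lambda>(x, y). f x y)" "a < f x0 x0"
  obtains \<rho> where "0 < \<rho>" "\<And>x y. \<lbrakk>x \<in> ball x0 \<rho>; y \<in> ball x0 \<rho>\<rbrakk> \<Longrightarrow> a \<le> f x y"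
proof -
  have "isCont (\<lambda>(x, y). f x y) (x0, x0)"
    using assms(1) by (simp add: continuous_on_eq_continuous_at)
  then have "((\<lambda>(x, y). f x y) \<longlongrightarrow> f x0 x0) (nhds (x0, x0))"
    using tendsto_at_iff_tendsto_nhds[of "\<lambda>(x, y). f x y" "(x0, x0)"] by (simp add: isCont_def)
  then have "\<forall>\<^sub>F z in nhds x0 \<times>\<^sub>F nhds x0. a < (\<lambda>(x, y). f x y) z"
    using assms(2) by (intro order_tendstoD) (auto simp: nhds_prod)
  then obtain Q where "eventually Q (nhds x0)" and Q: "\<And>x y. Q x \<Longrightarrow> Q y \<Longrightarrow> a < f x y"
    by (auto simp: eventually_prod_same)
  then obtain \<rho> where "\<rho> > 0" "\<And>x. dist x x0 < \<rho> \<Longrightarrow> Q x"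
    by (auto simp: eventually_nhds_metric)
  then show ?thesis using Q by (intro that[of \<rho>]) (auto simp: dist_commute less_imp_le)
qed

context fractional_domain begin

text \<open>The improvement step sends \<open>q\<close> to \<open>p0 + \<kappa> * q\<close>, whose
  fixed point is \<open>Q\<close>; the \<open>j\<close>-th iterate of \<open>1\<close> is
  \<open>Q - \<kappa> ^ j * (Q - 1)\<close>. Every step loses some radius, so the induction treats
  all \<open>\<rho>' < \<rho>\<close> at once.\<close>

lemma iterated_local_bound:
  assumes lower: "1 \<le> p0" "0 < s0" "\<And>x y. \<lbrakk>x \<in> ball x0 \<rho>; y \<in> ball x0 \<rho>\<rbrakk> \<Longrightarrow> p0 \<le> p x y \<and> s0 \<le> s x y"
    and sub: "s0 * p0 < real DIM('a)" and M: "0 \<le> M" and \<kappa>: "\<kappa> = s0 * p0 / real DIM('a)"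
    and Q: "Q = p0 / (1 - \<kappa>)"
  shows "\<rho>' < \<rho> \<Longrightarrow> \<exists>M'\<ge>0. \<forall>u. controlled M u \<longrightarrow>
     (\<integral>\<^sup>+ y\<in>ball x0 \<rho>'. ennreal (\<bar>u y\<bar> powr (Q - \<kappa> ^ j * (Q - 1))) \<partial>L) \<le> ennreal M'"
proof (induction j arbitrary: \<rho>')
  case 0
  have "(\<integral>\<^sup>+ y\<in>ball x0 \<rho>'. ennreal \<bar>u y\<bar> \<partial>L) \<le> ennreal M" if "controlled M u" for u
  proof -
    have "(\<integral>\<^sup>+ y\<in>ball x0 \<rho>'. ennreal \<bar>u y\<bar> \<partial>L) \<le> (\<integral>\<^sup>+ y. ennreal \<bar>u y\<bar> \<partial>L)"
      by (intro nn_integral_mono) (auto simp: indicator_def)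
    then show ?thesis using that by (auto simp: controlled_def)
  qed
  then show ?case using M by auto
next
  case (Suc j)
  have \<kappa>01: "0 < \<kappa>" "\<kappa> < 1" using lower sub by (auto simp: \<kappa>)
  have Q1: "1 \<le> Q" using \<kappa>01 lower by (simp add: Q field_simps)
  have "\<kappa> ^ j * (Q - 1) \<le> 1 * (Q - 1)"
    using \<kappa>01 Q1 by (intro mult_right_mono) (auto simp: power_le_one)
  then have q: "1 \<le> Q - \<kappa> ^ j * (Q - 1)" by simp
  define \<rho>1 where "\<rho>1 = (\<rho>' + \<rho>) / 2"
  have \<rho>1: "\<rho>' < \<rho>1" "\<rho>1 < \<rho>" using Suc.prems by (auto simp: \<rho>1_def)
  obtain M1 where M1: "M1 \<ge> 0" "\<And>u. controlled M u \<Longrightarrow>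
     (\<integral>\<^sup>+ y\<in>ball x0 \<rho>1. ennreal (\<bar>u y\<bar> powr (Q - \<kappa> ^ j * (Q - 1))) \<partial>L) \<le> ennreal M1"
    using Suc.IH[OF \<rho>1(2)] by blast
  have low: "p0 \<le> p x y \<and> s0 \<le> s x y" if "x \<in> ball x0 \<rho>1" "y \<in> ball x0 \<rho>1" for x y
    using lower(3)[of x y] that \<rho>1 by auto
  obtain M' where "0 \<le> M'" and M':
    "\<And>u. \<lbrakk>u \<in> borel_measurable L; (\<integral>\<^sup>+ x. energy u x \<partial>L) \<le> 1;
       (\<integral>\<^sup>+ y\<in>ball x0 \<rho>1. ennreal (\<bar>u y\<bar> powr (Q - \<kappa> ^ j * (Q - 1))) \<partial>L) \<le> ennreal M1\<rbrakk> \<Longrightarrow>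
       (\<integral>\<^sup>+ y\<in>ball x0 \<rho>'. ennreal (\<bar>u y\<bar> powr (p0 + s0 * p0 / real DIM('a) * (Q - \<kappa> ^ j * (Q - 1)))) \<partial>L) \<le> ennreal M'"
    using integrability_improvement[OF lower(1,2) low \<rho>1(1) q M1(1)] by blast
  have "p0 = Q * (1 - \<kappa>)" using \<kappa>01 by (simp add: Q)
  then have "p0 + s0 * p0 / real DIM('a) * (Q - \<kappa> ^ j * (Q - 1)) = Q - \<kappa> ^ Suc j * (Q - 1)"
    unfolding \<kappa>[symmetric] by (simp add: algebra_simps)
  then have "(\<integral>\<^sup>+ y\<in>ball x0 \<rho>'. ennreal (\<bar>u y\<bar> powr (Q - \<kappa> ^ Suc j * (Q - 1))) \<partial>L) \<le> ennreal M'"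
    if "controlled M u" for u
    using M'[of u] M1(2)[OF that] that by (simp add: controlled_def)
  then show ?case using \<open>0 \<le> M'\<close> by blast
qed

text \<open>In the form \<open>p / (1 - s * p / n)\<close> the critical exponent depends
  continuously on \<open>s\<close> and \<open>p\<close>, so lowering both by a small
  \<open>\<delta>\<close> keeps it above \<open>t\<close>. The strict inequalities for
  \<open>p0\<close> and \<open>s0\<close> let them remain lower bounds in a neighbourhood of
  \<open>x0\<close>.\<close>

lemma below_critical_exponents:
  assumes "t < crit_exp s p x0"
  obtains p0 s0 where "1 \<le> p0" "p0 < p x0 x0" "0 < s0" "s0 < s x0 x0" "s0 * p0 < real DIM('a)"
    "t < p0 / (1 - s0 * p0 / real DIM('a))"
proof -
  let ?n = "real DIM('a)" and ?p = "p x0 x0" and ?s = "s x0 x0"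
  have n: "?n > 0" by simp
  have "?s * ?p / ?n < 1" using subcritical[of x0 x0] by simp
  then have ne: "1 - ?s * ?p / ?n > 0" by simp
  have crit: "crit_exp s p x0 = ?p / (1 - ?s * ?p / ?n)"
    using ne n by (simp add: crit_exp_def field_simps)
  have "((\<lambda>\<delta>. (?p - \<delta>) / (1 - (?s - \<delta>) * (?p - \<delta>) / ?n)) \<longlongrightarrow> (?p - 0) / (1 - (?s - 0) * (?p - 0) / ?n)) (at_right 0)"
    using ne by (intro tendsto_intros) auto
  then have 1: "\<forall>\<^sub>F \<delta> in at_right 0. t < (?p - \<delta>) / (1 - (?s - \<delta>) * (?p - \<delta>) / ?n)"
    using assms crit by (intro order_tendstoD) auto
  have "min (?p - 1) ?s > 0" using p_gt_1[of x0 x0] sigma(1) sigma(2)[of x0 x0] by auto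
  then have 2: "\<forall>\<^sub>F \<delta> in at_right 0. \<delta> < min (?p - 1) ?s"
    by (rule eventually_at_right_real[THEN eventually_mono]) auto
  obtain \<delta> where \<delta>: "0 < \<delta>" "t < (?p - \<delta>) / (1 - (?s - \<delta>) * (?p - \<delta>) / ?n)" "\<delta> < ?p - 1" "\<delta> < ?s"
    using eventually_happens[OF eventually_conj[OF eventually_at_right_less[of 0] eventually_conj[OF 1 2]]]
    by auto
  have "(?s - \<delta>) * (?p - \<delta>) \<le> ?s * ?p" using \<delta> by (intro mult_mono) auto
  then show ?thesis using \<delta> subcritical[of x0 x0] by (intro that[of "?p - \<delta>" "?s - \<delta>"]) auto
qed

text \<open>On a small ball \<open>p0\<close> and \<open>s0\<close> bound the exponents from below
  and \<open>g\<close> stays below a constant \<open>t\<close>, itself below the critical exponent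
  of \<open>p0\<close> and \<open>s0\<close>. Finitely many bootstrap steps pass \<open>t\<close>,
  and a constant exponent above \<open>g\<close> dominates the variable one up to a summand
  \<open>1\<close>.\<close>

lemma local_modular_bound:
  assumes g: "continuous_on (closure \<Omega>) g" "\<And>x. x \<in> closure \<Omega> \<Longrightarrow> 0 \<le> g x"
    and x0: "x0 \<in> closure \<Omega>" and crit: "g x0 < crit_exp s p x0" and M: "0 \<le> M"
  shows "\<exists>\<rho> M'. 0 < \<rho> \<and> 0 \<le> M' \<and> (\<forall>u. controlled M u \<longrightarrow>
     (\<integral>\<^sup>+ y\<in>ball x0 \<rho>. ennreal (\<bar>u y\<bar> powr g y) \<partial>L) \<le> ennreal M')"
proof -
  let ?n = "real DIM('a)"
  obtain t where t: "g x0 < t" "t < crit_exp s p x0" using crit dense by blast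
  obtain p0 s0 where ps: "1 \<le> p0" "p0 < p x0 x0" "0 < s0" "s0 < s x0 x0" "s0 * p0 < ?n"
      "t < p0 / (1 - s0 * p0 / ?n)"
    using below_critical_exponents[OF t(2)] by blast
  obtain \<rho>1 where \<rho>1: "\<rho>1 > 0" "\<And>x y. \<lbrakk>x \<in> ball x0 \<rho>1; y \<in> ball x0 \<rho>1\<rbrakk> \<Longrightarrow> p0 \<le> p x y"
    using continuous_pair_lower_bound[OF cont_p ps(2)] by blast
  obtain \<rho>2 where \<rho>2: "\<rho>2 > 0" "\<And>x y. \<lbrakk>x \<in> ball x0 \<rho>2; y \<in> ball x0 \<rho>2\<rbrakk> \<Longrightarrow> s0 \<le> s x y"
    using continuous_pair_lower_bound[OF cont_s ps(4)] by blast
  obtain \<rho>3 where \<rho>3: "\<rho>3 > 0" "\<And>x. \<lbrakk>x \<in> closure \<Omega>; dist x x0 < \<rho>3\<rbrakk> \<Longrightarrow> g x < t"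
  proof -
    obtain d where "d > 0" "\<And>x. \<lbrakk>x \<in> closure \<Omega>; dist x x0 < d\<rbrakk> \<Longrightarrow> dist (g x) (g x0) < t - g x0"
      using g(1) x0 t(1) unfolding continuous_on_iff by (metis diff_gt_0_iff_gt)
    then show ?thesis by (intro that[of d]) (auto simp: dist_real_def abs_less_iff)
  qed
  define \<rho> where "\<rho> = Min {\<rho>1, \<rho>2, \<rho>3}"
  have \<rho>: "\<rho> > 0" "\<rho> \<le> \<rho>1" "\<rho> \<le> \<rho>2" "\<rho> \<le> \<rho>3" using \<rho>1 \<rho>2 \<rho>3 by (auto simp: \<rho>_def)
  define \<kappa> where "\<kappa> = s0 * p0 / ?n"
  define Q where "Q = p0 / (1 - \<kappa>)"
  have \<kappa>01: "0 < \<kappa>" "\<kappa> < 1" using ps by (auto simp: \<kappa>_def)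
  have "(\<lambda>j. Q - \<kappa> ^ j * (Q - 1)) \<longlonglongrightarrow> Q - 0 * (Q - 1)"
    using \<kappa>01 by (intro tendsto_intros LIMSEQ_power_zero) auto
  then have "\<forall>\<^sub>F j in sequentially. t < Q - \<kappa> ^ j * (Q - 1)"
    using ps(6) by (intro order_tendstoD) (auto simp: Q_def \<kappa>_def)
  then obtain j where j: "t < Q - \<kappa> ^ j * (Q - 1)" using eventually_happens by force
  define q where "q = Q - \<kappa> ^ j * (Q - 1)"
  have "p0 \<le> p x y \<and> s0 \<le> s x y" if "x \<in> ball x0 \<rho>" "y \<in> ball x0 \<rho>" for x y
    using \<rho>1(2)[of x y] \<rho>2(2)[of x y] that \<rho> by auto
  moreover have "\<rho>/2 < \<rho>" using \<rho> by simp
  ultimately obtain M' where M': "M' \<ge> 0" "\<And>u. controlled M u \<Longrightarrow>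
     (\<integral>\<^sup>+ y\<in>ball x0 (\<rho>/2). ennreal (\<bar>u y\<bar> powr q) \<partial>L) \<le> ennreal M'"
    using iterated_local_bound[OF ps(1,3) _ ps(5) M \<kappa>_def Q_def, of x0 \<rho> "\<rho>/2" j] unfolding q_def by blast
  have "(\<integral>\<^sup>+ y\<in>ball x0 (\<rho>/2). ennreal (\<bar>u y\<bar> powr g y) \<partial>L) \<le> ennreal (measure L \<Omega> + M')"
    if u: "controlled M u" for u
  proof -
    have [measurable]: "u \<in> borel_measurable L" using u by (simp add: controlled_def)
    have "(\<integral>\<^sup>+ y\<in>ball x0 (\<rho>/2). ennreal (\<bar>u y\<bar> powr g y) \<partial>L) \<le>
        (\<integral>\<^sup>+ y. 1 + ennreal (\<bar>u y\<bar> powr q) * indicator (ball x0 (\<rho>/2)) y \<partial>L)"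
    proof (rule nn_integral_mono)
      fix y assume "y \<in> space L"
      then have y: "y \<in> closure \<Omega>" using closure_subset by auto
      show "ennreal (\<bar>u y\<bar> powr g y) * indicator (ball x0 (\<rho>/2)) y \<le> 1 + ennreal (\<bar>u y\<bar> powr q) * indicator (ball x0 (\<rho>/2)) y"
      proof (cases "y \<in> ball x0 (\<rho>/2)")
        case True
        then have "dist x0 y < \<rho>3" using \<rho> by auto
        then have "g y \<le> q" using \<rho>3(2)[OF y] j by (simp add: q_def dist_commute)
        then have "\<bar>u y\<bar> powr g y \<le> 1 + \<bar>u y\<bar> powr q"
          using g(2)[OF y] by (intro powr_le_one_plus_powr) auto
        then have "ennreal (\<bar>u y\<bar> powr g y) \<le> 1 + ennreal (\<bar>u y\<bar> powr q)"
          by (simp add: ennreal_leI flip: ennreal_plus ennreal_1)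
        then show ?thesis using True by simp
      qed auto
    qed
    also have "\<dots> = emeasure L \<Omega> + (\<integral>\<^sup>+ y\<in>ball x0 (\<rho>/2). ennreal (\<bar>u y\<bar> powr q) \<partial>L)"
      by (subst nn_integral_add) auto
    also have "\<dots> \<le> ennreal (measure L \<Omega>) + ennreal M'"
      using M'(2)[OF u] by (intro add_mono) (auto simp: emeasure_eq_measure)
    finally show ?thesis using M'(1) by simp
  qed
  then show ?thesis using \<rho> M'(1) by (intro exI[of _ "\<rho>/2"] exI[of _ "measure L \<Omega> + M'"]) auto
qed

text \<open>Subcriticality up to the boundary gives a local bound at each point of the compact
  closure; the bounds over a finite subcover are added.\<close>

lemma uniform_modular_bound:
  assumes g: "continuous_on (closure \<Omega>) g" "\<And>x. x \<in> closure \<Omega> \<Longrightarrow> 0 \<le> g x"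
    and crit: "\<And>x. x \<in> closure \<Omega> \<Longrightarrow> g x < crit_exp s p x" and M: "0 \<le> M"
  obtains M' where "0 \<le> M'" "\<And>u. controlled M u \<Longrightarrow> (\<integral>\<^sup>+ y. ennreal (\<bar>u y\<bar> powr g y) \<partial>L) \<le> ennreal M'"
proof -
  obtain \<rho> M' where \<rho>: "\<And>x0. x0 \<in> closure \<Omega> \<Longrightarrow> 0 < \<rho> x0"
    and M': "\<And>x0. x0 \<in> closure \<Omega> \<Longrightarrow> 0 \<le> M' x0"
    and bound: "\<And>x0 u. \<lbrakk>x0 \<in> closure \<Omega>; controlled M u\<rbrakk> \<Longrightarrow>
       (\<integral>\<^sup>+ y\<in>ball x0 (\<rho> x0). ennreal (\<bar>u y\<bar> powr g y) \<partial>L) \<le> ennreal (M' x0)"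
    using local_modular_bound[OF g _ crit M] by metis
  have "compact (closure \<Omega>)" using bounded_dom by auto
  then obtain T where T: "T \<subseteq> closure \<Omega>" "finite T" "closure \<Omega> \<subseteq> (\<Union>x0\<in>T. ball x0 (\<rho> x0))"
    by (rule compactE_image[of _ "closure \<Omega>" "\<lambda>x0. ball x0 (\<rho> x0)"]) (use \<rho> in force)+
  note [measurable] = continuous_exponent_measurable[OF g(1)]
  show ?thesis
  proof (rule that[of "\<Sum>x0\<in>T. M' x0"])
    show "0 \<le> (\<Sum>x0\<in>T. M' x0)" using M' T by (intro sum_nonneg) auto
    fix u assume u: "controlled M u"
    have [measurable]: "u \<in> borel_measurable L" using u by (simp add: controlled_def)
    have "(\<integral>\<^sup>+ y. ennreal (\<bar>u y\<bar> powr g y) \<partial>L) \<le>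
       (\<integral>\<^sup>+ y. (\<Sum>x0\<in>T. ennreal (\<bar>u y\<bar> powr g y) * indicator (ball x0 (\<rho> x0)) y) \<partial>L)"
    proof (rule nn_integral_mono)
      fix y assume "y \<in> space L"
      then obtain x0 where x0: "x0 \<in> T" "y \<in> ball x0 (\<rho> x0)" using T closure_subset by force
      then have "ennreal (\<bar>u y\<bar> powr g y) = ennreal (\<bar>u y\<bar> powr g y) * indicator (ball x0 (\<rho> x0)) y" by simp
      also have "\<dots> \<le> (\<Sum>x0\<in>T. ennreal (\<bar>u y\<bar> powr g y) * indicator (ball x0 (\<rho> x0)) y)"
        using T x0 by (intro member_le_sum) auto
      finally show "ennreal (\<bar>u y\<bar> powr g y) \<le> (\<Sum>x0\<in>T. ennreal (\<bar>u y\<bar> powr g y) * indicator (ball x0 (\<rho> x0)) y)" .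
    qed
    also have "\<dots> = (\<Sum>x0\<in>T. (\<integral>\<^sup>+ y\<in>ball x0 (\<rho> x0). ennreal (\<bar>u y\<bar> powr g y) \<partial>L))"
      by (rule nn_integral_sum) measurable
    also have "\<dots> \<le> (\<Sum>x0\<in>T. ennreal (M' x0))"
      using bound u T by (intro sum_mono) auto
    also have "\<dots> = ennreal (\<Sum>x0\<in>T. M' x0)"
      using M' T by (intro sum_ennreal) auto
    finally show "(\<integral>\<^sup>+ y. ennreal (\<bar>u y\<bar> powr g y) \<partial>L) \<le> ennreal (\<Sum>x0\<in>T. M' x0)" .
  qed
qed

section \<open>Compactness in \<open>L\<^sup>1\<close>\<close>

text \<open>As \<open>ball z r\<close> lies within distance \<open>2 * r\<close> of
  \<open>x\<close>, the difference estimate applies with the global lower bounds \<open>1\<close>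
  and \<open>\<sigma>\<close> and with \<open>h = 1\<close>. The ball is centred at \<open>z\<close>
  rather than at \<open>x\<close>, so that finitely many averages serve all points.\<close>

lemma ball_average_close:
  assumes u: "controlled M u" and x: "x \<in> \<Omega>" and z: "z \<in> \<Omega>" "x \<in> ball z r" and fin: "energy u x \<noteq> \<infinity>"
    and r: "0 < r" "2 * r \<le> R"
  shows "\<bar>u x - (\<integral>y. indicator (\<Omega> \<inter> ball z r) y * u y \<partial>L) / measure L (\<Omega> \<inter> ball z r)\<bar>
    \<le> (2 * r) powr \<sigma> * (1 + 2 powr real DIM('a) / c * enn2real (energy u x))"
proof -
  let ?n = "real DIM('a)"
  define A where "A = \<Omega> \<inter> ball z r"
  have A [measurable]: "A \<in> sets L" unfolding A_def by (rule sets_L_ball)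
  define m where "m = measure L A"
  define g where "g = enn2real (energy u x)"
  have [measurable]: "u \<in> borel_measurable L" using u by (simp add: controlled_def)
  have int: "integrable L u"
    using u by (intro integrableI_bounded) (auto simp: controlled_def intro: le_less_trans)
  have rR: "r \<le> R" using r by simp
  have rn: "c * r powr ?n \<le> m"
    using density_L[OF z(1) r(1) rR] by (simp add: A_def m_def)
  have rpos: "0 < c * r powr ?n" using r cR by simp
  then have m: "m > 0" using rn by linarith
  have int1: "integrable L (\<lambda>y. indicator A y * u y)" "integrable L (\<lambda>y. indicator A y * u x)"
    using integrable_mult_indicator[OF A int] integrable_mult_indicator[OF A integrable_const[of "u x"]] by simp_all
  have "(\<integral>y. indicator A y * (u x - u y) \<partial>L) = (\<integral>y. indicator A y * u x \<partial>L) - (\<integral>y. indicator A y * u y \<partial>L)"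
    using int1 by (simp add: right_diff_distrib)
  also have "(\<integral>y. indicator A y * u x \<partial>L) = m * u x"
    using A sets.sets_into_space[OF A] by (simp add: m_def Int_absorb2)
  finally have eq: "m * u x - (\<integral>y. indicator A y * u y \<partial>L) = (\<integral>y. indicator A y * (u x - u y) \<partial>L)" by simp
  have "ennreal \<bar>\<integral>y. indicator A y * (u x - u y) \<partial>L\<bar> \<le> (\<integral>\<^sup>+ y. ennreal (norm (indicator A y * (u x - u y))) \<partial>L)"
    using integral_norm_bound_ennreal[of L "\<lambda>y. indicator A y * (u x - u y)"] int1
    by (simp add: right_diff_distrib)
  also have "\<dots> = (\<integral>\<^sup>+ y\<in>A. ennreal \<bar>u x - u y\<bar> \<partial>L)"
    by (intro nn_integral_cong) (auto simp: indicator_def)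
  also have "\<dots> \<le> ennreal ((2 * r) powr \<sigma> * (1 * measure L A + 1 powr (1 - 1) * (2 * r) powr ?n * enn2real (energy u x)))"
  proof (rule nn_integral_difference_le)
    show "A \<subseteq> cball x (2 * r)"
    proof
      fix y assume "y \<in> A"
      then show "y \<in> cball x (2 * r)" using z dist_triangle[of x y z] by (auto simp: A_def dist_commute)
    qed
  qed (use x fin r cR sigma p_gt_1 A in \<open>auto intro: less_imp_le\<close>)
  finally have "\<bar>m * u x - (\<integral>y. indicator A y * u y \<partial>L)\<bar> \<le> (2 * r) powr \<sigma> * (m + (2 * r) powr ?n * g)"
    unfolding eq by (subst (asm) ennreal_le_iff) (auto simp: m_def g_def)
  \<comment> \<open>The factor \<open>2 powr ?n\<close> compares the radius \<open>2 * r\<close> of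
    the estimate with the radius \<open>r\<close> of the density bound.\<close>
  also have "(2 * r) powr ?n * g \<le> m * (2 powr ?n / c * g)"
  proof -
    have "(2 * r) powr ?n = 2 powr ?n / c * (c * r powr ?n)" using r cR by (simp add: powr_mult)
    also have "\<dots> \<le> 2 powr ?n / c * m" using rn cR by (intro mult_left_mono) auto
    finally have "(2 * r) powr ?n * g \<le> 2 powr ?n / c * m * g" by (rule mult_right_mono) (simp add: g_def)
    then show ?thesis by (simp add: algebra_simps)
  qed
  finally have "\<bar>m * u x - (\<integral>y. indicator A y * u y \<partial>L)\<bar> \<le> (2 * r) powr \<sigma> * (m + m * (2 powr ?n / c * g))"
    by (simp add: mult_left_mono)
  then have "\<bar>m * u x - (\<integral>y. indicator A y * u y \<partial>L)\<bar> / m \<le> (2 * r) powr \<sigma> * (m + m * (2 powr ?n / c * g)) / m"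
    using m by (intro divide_right_mono) auto
  also have "\<bar>m * u x - (\<integral>y. indicator A y * u y \<partial>L)\<bar> / m = \<bar>u x - (\<integral>y. indicator A y * u y \<partial>L) / m\<bar>"
  proof -
    have "u x - (\<integral>y. indicator A y * u y \<partial>L) / m = (m * u x - (\<integral>y. indicator A y * u y \<partial>L)) / m"
      using m by (simp add: diff_divide_distrib)
    then show ?thesis using m by (simp only: abs_divide abs_of_pos)
  qed
  also have "(2 * r) powr \<sigma> * (m + m * (2 powr ?n / c * g)) / m = (2 * r) powr \<sigma> * (1 + 2 powr ?n / c * g)"
    using m by (simp add: field_simps)
  finally show ?thesis by (simp add: m_def A_def g_def)
qed

text \<open>Compare both functions at \<open>x\<close> with their averages over a ball of the net
  containing \<open>x\<close>; these averages differ by at most \<open>\<epsilon>\<close>. On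
  integration each energy contributes at most \<open>1\<close>, so the remaining error is of order
  \<open>(2 * r) powr \<sigma>\<close>, uniformly in the class.\<close>

lemma controlled_L1_difference:
  assumes u: "controlled M u" "controlled M w" and r: "0 < r" "2 * r \<le> R" and \<epsilon>: "0 \<le> \<epsilon>"
    and net: "F \<subseteq> \<Omega>" "\<Omega> \<subseteq> (\<Union>z\<in>F. ball z r)"
    and close: "\<And>z. z \<in> F \<Longrightarrow> \<bar>(\<integral>y. indicator (\<Omega> \<inter> ball z r) y * u y \<partial>L)
       - (\<integral>y. indicator (\<Omega> \<inter> ball z r) y * w y \<partial>L)\<bar> \<le> \<epsilon> * measure L (\<Omega> \<inter> ball z r)"
  shows "(\<integral>\<^sup>+ x. ennreal \<bar>u x - w x\<bar> \<partial>L) \<le>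
    ennreal ((2 * r) powr \<sigma> * (2 * measure L \<Omega> + 2 * (2 powr real DIM('a) / c)) + \<epsilon> * measure L \<Omega>)"
proof -
  define C where "C = 2 powr real DIM('a) / c"
  define \<theta> where "\<theta> = (2 * r) powr \<sigma>"
  have C: "C \<ge> 0" "\<theta> \<ge> 0" using cR by (auto simp: C_def \<theta>_def)
  have [measurable]: "u \<in> borel_measurable L" "w \<in> borel_measurable L" using u by (auto simp: controlled_def)
  have enu: "(\<integral>\<^sup>+ x. energy u x \<partial>L) \<le> 1" "(\<integral>\<^sup>+ x. energy w x \<partial>L) \<le> 1"
    using u by (auto simp: controlled_def)
  have "AE x in L. energy u x \<noteq> \<infinity>" "AE x in L. energy w x \<noteq> \<infinity>"
    using enu by (intro nn_integral_PInf_AE; auto simp: top_unique)+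
  then have "AE x in L. energy u x \<noteq> \<infinity> \<and> energy w x \<noteq> \<infinity>" by simp
  then have "AE x in L. ennreal \<bar>u x - w x\<bar> \<le> ennreal (2 * \<theta> + \<epsilon>) + ennreal (\<theta> * C) * (energy u x + energy w x)"
  proof (rule AE_mp, intro AE_I2 impI)
    fix x assume "x \<in> space L" and fin: "energy u x \<noteq> \<infinity> \<and> energy w x \<noteq> \<infinity>"
    then have x: "x \<in> \<Omega>" by simp
    then obtain z where z: "z \<in> F" "x \<in> ball z r" using net by blast
    then have zO: "z \<in> \<Omega>" using net by blast
    define m where "m = measure L (\<Omega> \<inter> ball z r)"
    define gu gw where "gu = enn2real (energy u x)" and "gw = enn2real (energy w x)"
    have g: "gu \<ge> 0" "energy u x = ennreal gu" "gw \<ge> 0" "energy w x = ennreal gw"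
      using fin by (auto simp: gu_def gw_def less_top)
    define Iu Iw where "Iu = (\<integral>y. indicator (\<Omega> \<inter> ball z r) y * u y \<partial>L)"
      and "Iw = (\<integral>y. indicator (\<Omega> \<inter> ball z r) y * w y \<partial>L)"
    have "r \<le> R" using r by simp
    then have "c * r powr real DIM('a) \<le> m" using density_L[OF zO r(1)] by (simp add: m_def)
    moreover have "c * r powr real DIM('a) > 0" using r cR by simp
    ultimately have m: "m > 0" by linarith
    have 1: "\<bar>u x - Iu / m\<bar> \<le> \<theta> * (1 + C * gu)"
      using ball_average_close[OF u(1) x zO z(2) _ r] fin by (simp add: m_def Iu_def gu_def \<theta>_def C_def)
    have 2: "\<bar>w x - Iw / m\<bar> \<le> \<theta> * (1 + C * gw)"
      using ball_average_close[OF u(2) x zO z(2) _ r] fin by (simp add: m_def Iw_def gw_def \<theta>_def C_def)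
    have "\<bar>Iu - Iw\<bar> \<le> \<epsilon> * m" using close[OF z(1)] by (simp add: m_def Iu_def Iw_def)
    then have "\<bar>(Iu - Iw) / m\<bar> \<le> \<epsilon>" using m by (simp add: abs_divide divide_le_eq)
    then have 3: "\<bar>Iu / m - Iw / m\<bar> \<le> \<epsilon>" by (simp add: diff_divide_distrib)
    have "\<bar>u x - w x\<bar> \<le> \<theta> * (1 + C * gu) + \<theta> * (1 + C * gw) + \<epsilon>" using 1 2 3 by linarith
    also have "\<dots> = (2 * \<theta> + \<epsilon>) + \<theta> * C * (gu + gw)" by (simp add: algebra_simps)
    finally show "ennreal \<bar>u x - w x\<bar> \<le> ennreal (2 * \<theta> + \<epsilon>) + ennreal (\<theta> * C) * (energy u x + energy w x)"
      using C g \<epsilon> by (simp add: ennreal_leI flip: ennreal_mult ennreal_plus)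
  qed
  then have "(\<integral>\<^sup>+ x. ennreal \<bar>u x - w x\<bar> \<partial>L) \<le>
      (\<integral>\<^sup>+ x. ennreal (2 * \<theta> + \<epsilon>) + ennreal (\<theta> * C) * (energy u x + energy w x) \<partial>L)"
    by (rule nn_integral_mono_AE)
  also have "\<dots> = ennreal (2 * \<theta> + \<epsilon>) * emeasure L \<Omega>
      + ennreal (\<theta> * C) * ((\<integral>\<^sup>+ x. energy u x \<partial>L) + (\<integral>\<^sup>+ x. energy w x \<partial>L))"
    by (simp add: nn_integral_add nn_integral_cmult)
  also have "\<dots> \<le> ennreal (2 * \<theta> + \<epsilon>) * ennreal (measure L \<Omega>) + ennreal (\<theta> * C) * (1 + 1)"
    using enu by (intro add_mono mult_left_mono) (auto simp: emeasure_eq_measure)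
  also have "(1 + 1 :: ennreal) = ennreal 2" by simp
  also have "ennreal (2 * \<theta> + \<epsilon>) * ennreal (measure L \<Omega>) + ennreal (\<theta> * C) * ennreal 2
      = ennreal ((2 * \<theta> + \<epsilon>) * measure L \<Omega> + \<theta> * C * 2)"
    using C \<epsilon> by (simp add: ennreal_mult del: ennreal_numeral)
  also have "(2 * \<theta> + \<epsilon>) * measure L \<Omega> + \<theta> * C * 2 = \<theta> * (2 * measure L \<Omega> + 2 * C) + \<epsilon> * measure L \<Omega>"
    by (simp add: algebra_simps)
  finally show ?thesis by (simp add: C_def \<theta>_def)
qed

text \<open>The centres are taken in \<open>\<Omega>\<close> and not merely in its closure, because
  \<open>density\<close> is stated for such points.\<close>

lemma finite_net:
  assumes "0 < r"
  obtains F where "finite F" "F \<subseteq> \<Omega>" "\<Omega> \<subseteq> (\<Union>z\<in>F. ball z r)"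
proof -
  have "compact (closure \<Omega>)" using bounded_dom by auto
  then obtain F where "F \<subseteq> \<Omega>" "finite F" "closure \<Omega> \<subseteq> (\<Union>z\<in>F. ball z r)"
  proof (rule compactE_image[of _ \<Omega> "\<lambda>z. ball z r"])
    show "closure \<Omega> \<subseteq> (\<Union>z\<in>\<Omega>. ball z r)"
      using assms by (auto simp: closure_approachable)
  qed auto
  then show ?thesis using closure_subset[of \<Omega>] by (intro that[of F]) blast+
qed

text \<open>Over the nets of all scales only countably many averages occur, each bounded by
  \<open>M\<close>, and a diagonal subsequence makes all of them converge. At a fixed scale finitely
  many averages have to be close; \<open>controlled_L1_difference\<close> makes the error of the
  scale small.\<close>

lemma controlled_L1_precompact:
  assumes f: "\<And>k. controlled M (f k)" and M: "0 \<le> M"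
  obtains r where "strict_mono (r :: nat \<Rightarrow> nat)"
    "\<And>\<epsilon>. \<epsilon> > 0 \<Longrightarrow> \<exists>k0. \<forall>j\<ge>k0. \<forall>k\<ge>k0. (\<integral>\<^sup>+ x. ennreal \<bar>f (r j) x - f (r k) x\<bar> \<partial>L) \<le> ennreal \<epsilon>"
proof -
  \<comment> \<open>These scales satisfy \<open>2 * \<rho> i \<le> R\<close> and tend to
    \<open>0\<close>.\<close>
  define \<rho> where "\<rho> = (\<lambda>i. R / (2 * real (Suc i)))"
  have \<rho>: "0 < \<rho> i" "2 * \<rho> i \<le> R" for i
    using cR by (auto simp: \<rho>_def field_simps)
  have "\<exists>F. finite F \<and> F \<subseteq> \<Omega> \<and> \<Omega> \<subseteq> (\<Union>z\<in>F. ball z (\<rho> i))" for i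
    using finite_net[OF \<rho>(1)] by metis
  then obtain F where F: "\<And>i. finite (F i)" "\<And>i. F i \<subseteq> \<Omega>" "\<And>i. \<Omega> \<subseteq> (\<Union>z\<in>F i. ball z (\<rho> i))"
    by metis
  define \<Phi> where "\<Phi> = (\<lambda>k (i, z). \<integral>y. indicator (\<Omega> \<inter> ball z (\<rho> i)) y * f k y \<partial>L)"
  have fm [measurable]: "f k \<in> borel_measurable L" for k using f by (simp add: controlled_def)
  have \<Phi>M: "norm (\<Phi> k iz) \<le> M" for k iz
  proof -
    obtain i z where iz: "iz = (i, z)" by force
    have int: "integrable L (f k)"
      using f[of k] by (intro integrableI_bounded) (auto simp: controlled_def intro: le_less_trans)
    have "ennreal (norm (\<Phi> k iz)) \<le> (\<integral>\<^sup>+ y. ennreal (norm (indicator (\<Omega> \<inter> ball z (\<rho> i)) y * f k y)) \<partial>L)"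
      unfolding \<Phi>_def iz prod.case
      using integrable_mult_indicator[OF sets_L_ball int] by (intro integral_norm_bound_ennreal) simp
    also have "\<dots> \<le> (\<integral>\<^sup>+ y. ennreal \<bar>f k y\<bar> \<partial>L)"
      by (intro nn_integral_mono ennreal_leI) (auto simp: indicator_def)
    also have "\<dots> \<le> ennreal M" using f[of k] by (simp add: controlled_def)
    finally show ?thesis using M by simp
  qed
  have "countable (UNIV \<times> (\<Union>i. F i) :: (nat \<times> 'a) set)"
    using F by (intro countable_SIGMA countable_UN) (auto intro: countable_finite)
  \<comment> \<open>\<open>function_convergent_subsequence\<close> is the Cantor diagonal argument
    for a bounded family with countable index set.\<close>
  then obtain r where r: "strict_mono (r :: nat \<Rightarrow> nat)"
    and conv: "\<And>iz. iz \<in> UNIV \<times> (\<Union>i. F i) \<Longrightarrow> \<exists>l. (\<lambda>k. \<Phi> (r k) iz) \<longlonglongrightarrow> l"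
    using function_convergent_subsequence[of _ \<Phi> M] \<Phi>M by blast
  show ?thesis
  proof (rule that[OF r])
    fix \<epsilon> :: real assume \<epsilon>: "\<epsilon> > 0"
    define B where "B = 2 * measure L \<Omega> + 2 * (2 powr real DIM('a) / c)"
    have "(\<lambda>i. (R * inverse (real (Suc i))) powr \<sigma> * B) \<longlonglongrightarrow> (R * 0) powr \<sigma> * B"
      using sigma cR by (intro tendsto_intros tendsto_powr' LIMSEQ_inverse_real_of_nat) (auto intro: always_eventually)
    then have "\<forall>\<^sub>F i in sequentially. (R * inverse (real (Suc i))) powr \<sigma> * B < \<epsilon> / 2"
      using \<epsilon> by (intro order_tendstoD) auto
    then obtain i where "(R * inverse (real (Suc i))) powr \<sigma> * B < \<epsilon> / 2"
      using eventually_happens by force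
    moreover have "2 * \<rho> i = R * inverse (real (Suc i))"
      by (simp add: \<rho>_def field_simps del: of_nat_Suc)
    ultimately have i: "(2 * \<rho> i) powr \<sigma> * B < \<epsilon> / 2" by (simp del: of_nat_Suc)
    \<comment> \<open>The summand \<open>1\<close> keeps the denominator positive and still gives
      \<open>\<eta> * measure L \<Omega> \<le> \<epsilon> / 2\<close>.\<close>
    define \<eta> where "\<eta> = \<epsilon> / 2 / (measure L \<Omega> + 1)"
    have \<eta>: "\<eta> > 0" using \<epsilon> by (simp add: \<eta>_def add_nonneg_pos)
    have "\<exists>k0. \<forall>j\<ge>k0. \<forall>k\<ge>k0. \<bar>\<Phi> (r j) (i, z) - \<Phi> (r k) (i, z)\<bar> \<le> \<eta> * measure L (\<Omega> \<inter> ball z (\<rho> i))"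
      if z: "z \<in> F i" for z
    proof -
      have cau: "Cauchy (\<lambda>k. \<Phi> (r k) (i, z))"
        using conv[of "(i, z)"] z by (auto intro: LIMSEQ_imp_Cauchy)
      have "\<rho> i \<le> R" "z \<in> \<Omega>" using \<rho>[of i] z F by auto
      then have "c * \<rho> i powr real DIM('a) \<le> measure L (\<Omega> \<inter> ball z (\<rho> i))" using density_L \<rho>(1) by blast
      moreover have "0 < c * \<rho> i powr real DIM('a)" using cR \<rho>(1)[of i] by simp
      ultimately have "0 < measure L (\<Omega> \<inter> ball z (\<rho> i))" by linarith
      then have "0 < \<eta> * measure L (\<Omega> \<inter> ball z (\<rho> i))" using \<eta> by simp
      then obtain k0 where "\<forall>j\<ge>k0. \<forall>k\<ge>k0.
          dist (\<Phi> (r j) (i, z)) (\<Phi> (r k) (i, z)) < \<eta> * measure L (\<Omega> \<inter> ball z (\<rho> i))"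
        using cau unfolding Cauchy_def by blast
      then show ?thesis unfolding dist_real_def by (intro exI[of _ k0]) (auto intro: less_imp_le)
    qed
    then obtain k0 where k0: "\<And>z j k. \<lbrakk>z \<in> F i; j \<ge> k0 z; k \<ge> k0 z\<rbrakk> \<Longrightarrow>
        \<bar>\<Phi> (r j) (i, z) - \<Phi> (r k) (i, z)\<bar> \<le> \<eta> * measure L (\<Omega> \<inter> ball z (\<rho> i))"
      by metis
    \<comment> \<open>\<open>Max\<close> of an empty set is unspecified; inserting \<open>0\<close>
      covers an empty net.\<close>
    define K where "K = Max (insert 0 (k0 ` F i))"
    have K: "k0 z \<le> K" if "z \<in> F i" for z using that F by (auto simp: K_def)
    have "(\<integral>\<^sup>+ x. ennreal \<bar>f (r j) x - f (r k) x\<bar> \<partial>L) \<le> ennreal \<epsilon>" if "j \<ge> K" "k \<ge> K" for j k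
    proof -
      have "(\<integral>\<^sup>+ x. ennreal \<bar>f (r j) x - f (r k) x\<bar> \<partial>L) \<le> ennreal ((2 * \<rho> i) powr \<sigma> * B + \<eta> * measure L \<Omega>)"
        unfolding B_def
      proof (rule controlled_L1_difference[OF f f \<rho> less_imp_le[OF \<eta>] F(2) F(3)])
        fix z assume z: "z \<in> F i"
        then have "k0 z \<le> j" "k0 z \<le> k" using K[OF z] that by auto
        then show "\<bar>(\<integral>y. indicator (\<Omega> \<inter> ball z (\<rho> i)) y * f (r j) y \<partial>L) - (\<integral>y. indicator (\<Omega> \<inter> ball z (\<rho> i)) y * f (r k) y \<partial>L)\<bar>
           \<le> \<eta> * measure L (\<Omega> \<inter> ball z (\<rho> i))"
          using k0[OF z] by (simp add: \<Phi>_def)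
      qed
      also have "\<dots> \<le> ennreal \<epsilon>"
      proof (rule ennreal_leI)
        have "\<eta> * measure L \<Omega> \<le> \<eta> * (measure L \<Omega> + 1)" using \<eta> by (intro mult_left_mono) auto
        also have "\<dots> = \<epsilon> / 2"
        proof -
          have "measure L \<Omega> + 1 \<noteq> 0" using measure_nonneg[of L \<Omega>] by linarith
          then show ?thesis by (rule nonzero_eq_divide_eq[THEN iffD1, OF _ \<eta>_def])
        qed
        finally show "(2 * \<rho> i) powr \<sigma> * B + \<eta> * measure L \<Omega> \<le> \<epsilon>" using i by linarith
      qed
      finally show ?thesis .
    qed
    then show "\<exists>k0. \<forall>j\<ge>k0. \<forall>k\<ge>k0. (\<integral>\<^sup>+ x. ennreal \<bar>f (r j) x - f (r k) x\<bar> \<partial>L) \<le> ennreal \<epsilon>" by blast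
  qed
qed

section \<open>The embedding\<close>

lemma var_modular_scale:
  assumes [measurable]: "u \<in> borel_measurable L" "g \<in> borel_measurable L"
    and g: "\<And>x. x \<in> \<Omega> \<Longrightarrow> 1 \<le> g x" and a: "0 < a" "1 \<le> t"
  shows "var_modular \<Omega> g (\<lambda>x. u x / (t * a)) \<le> ennreal (1 / t) * var_modular \<Omega> g (\<lambda>x. u x / a)"
proof -
  have "(\<integral>\<^sup>+ x. ennreal (\<bar>u x / (t * a)\<bar> powr g x) \<partial>L) \<le> (\<integral>\<^sup>+ x. ennreal (1 / t) * ennreal (\<bar>u x / a\<bar> powr g x) \<partial>L)"
  proof (rule nn_integral_mono)
    fix x assume "x \<in> space L"
    then have "\<bar>u x / (t * a)\<bar> powr g x \<le> 1 / t * \<bar>u x / a\<bar> powr g x"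
      using g a by (intro powr_scale_le) auto
    then show "ennreal (\<bar>u x / (t * a)\<bar> powr g x) \<le> ennreal (1 / t) * ennreal (\<bar>u x / a\<bar> powr g x)"
      using a by (subst ennreal_mult[symmetric]) (auto intro: ennreal_leI)
  qed
  also have "\<dots> = ennreal (1 / t) * (\<integral>\<^sup>+ x. ennreal (\<bar>u x / a\<bar> powr g x) \<partial>L)"
    by (rule nn_integral_cmult) measurable
  finally show ?thesis by (simp only: var_modular_eq)
qed

lemma gag_modular_scale:
  assumes [measurable]: "u \<in> borel_measurable L" and a: "0 < a" "1 \<le> t"
  shows "gag_modular \<Omega> s p (\<lambda>x. u x / (t * a)) \<le> ennreal (1 / t) * gag_modular \<Omega> s p (\<lambda>x. u x / a)"
proof -
  have en: "energy (\<lambda>x. u x / (t * a)) x \<le> ennreal (1 / t) * energy (\<lambda>x. u x / a) x" if x: "x \<in> \<Omega>" for x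
  proof -
    have [measurable]: "(\<lambda>y. p x y) \<in> borel_measurable L" "(\<lambda>y. s x y) \<in> borel_measurable L"
      by (rule section_measurable_L[OF cont_p x] section_measurable_L[OF cont_s x])+
    let ?d = "\<lambda>y. norm (x - y) powr (real DIM('a) + s x y * p x y)"
    have "energy (\<lambda>x. u x / (t * a)) x \<le>
      (\<integral>\<^sup>+ y. ennreal (1 / t) * ennreal (\<bar>u x / a - u y / a\<bar> powr p x y / ?d y) \<partial>L)"
      unfolding energy_def
    proof (rule nn_integral_mono)
      fix y
      have "\<bar>(u x - u y) / (t * a)\<bar> powr p x y \<le> 1 / t * \<bar>(u x - u y) / a\<bar> powr p x y"
        using a p_gt_1[of x y] by (intro powr_scale_le) auto
      then have "\<bar>u x / (t * a) - u y / (t * a)\<bar> powr p x y \<le> 1 / t * \<bar>u x / a - u y / a\<bar> powr p x y"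
        by (simp only: diff_divide_distrib)
      then have "\<bar>u x / (t * a) - u y / (t * a)\<bar> powr p x y / ?d y \<le> 1 / t * \<bar>u x / a - u y / a\<bar> powr p x y / ?d y"
        by (intro divide_right_mono) auto
      then have "\<bar>u x / (t * a) - u y / (t * a)\<bar> powr p x y / ?d y \<le> 1 / t * (\<bar>u x / a - u y / a\<bar> powr p x y / ?d y)"
        by simp
      then show "ennreal (\<bar>u x / (t * a) - u y / (t * a)\<bar> powr p x y / ?d y) \<le>
          ennreal (1 / t) * ennreal (\<bar>u x / a - u y / a\<bar> powr p x y / ?d y)"
        using a by (subst ennreal_mult[symmetric]) (auto intro: ennreal_leI)
    qed
    also have "\<dots> = ennreal (1 / t) * energy (\<lambda>x. u x / a) x"
      unfolding energy_def by (rule nn_integral_cmult) measurable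
    finally show ?thesis .
  qed
  have "gag_modular \<Omega> s p (\<lambda>x. u x / (t * a)) \<le> (\<integral>\<^sup>+ x. ennreal (1 / t) * energy (\<lambda>x. u x / a) x \<partial>L)"
    unfolding gag_modular_eq using en by (intro nn_integral_mono) auto
  also have "\<dots> = ennreal (1 / t) * gag_modular \<Omega> s p (\<lambda>x. u x / a)"
    unfolding gag_modular_eq by (rule nn_integral_cmult) measurable
  finally show ?thesis .
qed

lemma lux_norm_le:
  assumes "0 < a" "var_modular \<Omega> g (\<lambda>x. u x / a) \<le> 1"
  shows "lux_norm \<Omega> g u \<le> a"
  unfolding lux_norm_def by (rule cInf_lower) (use assms in \<open>auto intro!: bdd_belowI[of _ 0]\<close>)

text \<open>Both summands of the norm are nonnegative, so a number \<open>a\<close> above the norm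
  exceeds each of them and both modulars of \<open>u / a\<close> are at most \<open>1\<close>;
  \<open>|t| \<le> 1 + |t| powr \<beta> x\<close> turns the first into an \<open>L\<^sup>1\<close>
  bound. The strict inequality makes \<open>a\<close> positive even when the norm is zero.\<close>

lemma Wspace_normalised:
  assumes \<beta>: "continuous_on (closure \<Omega>) \<beta>" "\<And>x. x \<in> closure \<Omega> \<Longrightarrow> 1 \<le> \<beta> x"
    and u: "u \<in> Wspace \<Omega> s \<beta> p"
  shows "0 \<le> W_norm \<Omega> s \<beta> p u"
    and "W_norm \<Omega> s \<beta> p u < a \<Longrightarrow> controlled (measure L \<Omega> + 1) (\<lambda>x. u x / a)"
proof -
  have um [measurable]: "u \<in> borel_measurable L" using u by (simp add: Wspace_def Lvar_def set_borel_measurable_iff)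
  have \<beta>m [measurable]: "\<beta> \<in> borel_measurable L" by (rule continuous_exponent_measurable[OF \<beta>(1)])
  have \<beta>1: "1 \<le> \<beta> x" if "x \<in> \<Omega>" for x using \<beta>(2) closure_subset that by blast
  obtain a1 where a1: "0 < a1" "var_modular \<Omega> \<beta> (\<lambda>x. u x / a1) < \<infinity>"
    using u by (auto simp: Wspace_def Lvar_def)
  obtain a2 where a2: "0 < a2" "gag_modular \<Omega> s p (\<lambda>x. u x / a2) < \<infinity>"
    using u by (auto simp: Wspace_def)
  note lux = Inf_scaling_modular[where \<rho> = "\<lambda>a. var_modular \<Omega> \<beta> (\<lambda>x. u x / a)" and P = "\<lambda>y. y \<le> 1",
      OF var_modular_scale[OF um \<beta>m \<beta>1] a1, folded lux_norm_def]
  note gag = Inf_scaling_modular[where \<rho> = "\<lambda>a. gag_modular \<Omega> s p (\<lambda>x. u x / a)" and P = "\<lambda>y. y < 1",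
      OF gag_modular_scale[OF um] a2, folded gag_seminorm_def]
  have nonneg: "0 \<le> lux_norm \<Omega> \<beta> u" "0 \<le> gag_seminorm \<Omega> s p u"
    using lux(1) gag(1) by (auto intro: less_imp_le)
  then show "0 \<le> W_norm \<Omega> s \<beta> p u" by (simp add: W_norm_def)
  assume "W_norm \<Omega> s \<beta> p u < a"
  then have "lux_norm \<Omega> \<beta> u < a" "gag_seminorm \<Omega> s p u < a" using nonneg by (auto simp: W_norm_def)
  then have mod: "var_modular \<Omega> \<beta> (\<lambda>x. u x / a) \<le> 1" "gag_modular \<Omega> s p (\<lambda>x. u x / a) \<le> 1"
    using lux(2)[of a] gag(2)[of a] by (auto intro: less_imp_le)
  have "(\<integral>\<^sup>+ x. ennreal \<bar>u x / a\<bar> \<partial>L) \<le> (\<integral>\<^sup>+ x. 1 + ennreal (\<bar>u x / a\<bar> powr \<beta> x) \<partial>L)"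
  proof (rule nn_integral_mono)
    fix x assume "x \<in> space L"
    then have "\<bar>u x / a\<bar> powr 1 \<le> 1 + \<bar>u x / a\<bar> powr \<beta> x" using \<beta>1 by (intro powr_le_one_plus_powr) auto
    then have "ennreal \<bar>u x / a\<bar> \<le> ennreal (1 + \<bar>u x / a\<bar> powr \<beta> x)" by (intro ennreal_leI) simp
    then show "ennreal \<bar>u x / a\<bar> \<le> 1 + ennreal (\<bar>u x / a\<bar> powr \<beta> x)" by simp
  qed
  also have "\<dots> = emeasure L \<Omega> + var_modular \<Omega> \<beta> (\<lambda>x. u x / a)"
    unfolding var_modular_eq by (subst nn_integral_add) auto
  also have "\<dots> \<le> ennreal (measure L \<Omega>) + 1" using mod by (intro add_mono) (auto simp: emeasure_eq_measure)
  also have "\<dots> = ennreal (measure L \<Omega> + 1)" by simp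
  finally show "controlled (measure L \<Omega> + 1) (\<lambda>x. u x / a)"
    using mod by (simp add: controlled_def gag_modular_eq)
qed

text \<open>For \<open>a\<close> above the norm of \<open>u\<close>, the modular of
  \<open>u / a\<close> with exponent \<open>\<gamma>\<close> is at most \<open>M' \<le> K\<close>;
  as \<open>\<gamma> \<ge> 1\<close> and \<open>K \<ge> 1\<close>, a further division by
  \<open>K\<close> brings it to at most \<open>1\<close>.\<close>

lemma embedding_bounded:
  assumes \<beta>: "continuous_on (closure \<Omega>) \<beta>" "\<And>x. x \<in> closure \<Omega> \<Longrightarrow> 1 \<le> \<beta> x"
    and \<gamma>: "continuous_on (closure \<Omega>) \<gamma>" "\<And>x. x \<in> closure \<Omega> \<Longrightarrow> 1 \<le> \<gamma> x"
      "\<And>x. x \<in> closure \<Omega> \<Longrightarrow> \<gamma> x < crit_exp s p x"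
  shows "\<exists>K>0. \<forall>u\<in>Wspace \<Omega> s \<beta> p. u \<in> Lvar \<Omega> \<gamma> \<and> lux_norm \<Omega> \<gamma> u \<le> K * W_norm \<Omega> s \<beta> p u"
proof -
  have "0 \<le> \<gamma> x" if "x \<in> closure \<Omega>" for x using \<gamma>(2)[OF that] by simp
  then obtain M' where M': "0 \<le> M'" "\<And>u. controlled (measure L \<Omega> + 1) u \<Longrightarrow>
      (\<integral>\<^sup>+ y. ennreal (\<bar>u y\<bar> powr \<gamma> y) \<partial>L) \<le> ennreal M'"
    using uniform_modular_bound[OF \<gamma>(1) _ \<gamma>(3), of "measure L \<Omega> + 1"] measure_nonneg[of L \<Omega>]
    by (metis add_nonneg_nonneg zero_le_one)
  have \<gamma>m [measurable]: "\<gamma> \<in> borel_measurable L" by (rule continuous_exponent_measurable[OF \<gamma>(1)])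
  have \<gamma>1: "1 \<le> \<gamma> x" if "x \<in> \<Omega>" for x using \<gamma>(2) closure_subset that by blast
  define K where "K = max 1 M'"
  have K: "K \<ge> 1" "M' \<le> K" by (auto simp: K_def)
  have "u \<in> Lvar \<Omega> \<gamma> \<and> lux_norm \<Omega> \<gamma> u \<le> K * W_norm \<Omega> s \<beta> p u" if u: "u \<in> Wspace \<Omega> s \<beta> p" for u
  proof -
    let ?W = "W_norm \<Omega> s \<beta> p u"
    have um [measurable]: "u \<in> borel_measurable L" using u by (simp add: Wspace_def Lvar_def set_borel_measurable_iff)
    have W: "0 \<le> ?W" by (rule Wspace_normalised(1)[OF \<beta> u])
    have mod: "var_modular \<Omega> \<gamma> (\<lambda>x. u x / a) \<le> ennreal M'" if "?W < a" for a
      unfolding var_modular_eq by (rule M'(2)[OF Wspace_normalised(2)[OF \<beta> u that]])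
    have lux: "lux_norm \<Omega> \<gamma> u \<le> K * a" if "?W < a" for a
    proof (rule lux_norm_le)
      show "0 < K * a" using K W that by simp
      have "var_modular \<Omega> \<gamma> (\<lambda>x. u x / (K * a)) \<le> ennreal (1 / K) * var_modular \<Omega> \<gamma> (\<lambda>x. u x / a)"
        using K W that \<gamma>1 by (intro var_modular_scale) auto
      also have "\<dots> \<le> ennreal (1 / K) * ennreal K"
        using mod[OF that] K by (intro mult_left_mono order_trans[OF mod[OF that]] ennreal_leI) auto
      also have "\<dots> = 1" using K by (simp flip: ennreal_mult)
      finally show "var_modular \<Omega> \<gamma> (\<lambda>x. u x / (K * a)) \<le> 1" .
    qed
    \<comment> \<open>Letting \<open>a\<close> decrease to \<open>?W\<close> avoids a division by
      the norm, which may be \<open>0\<close>.\<close>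
    have "lux_norm \<Omega> \<gamma> u / K \<le> ?W"
    proof (rule dense_ge)
      fix a assume "?W < a"
      then show "lux_norm \<Omega> \<gamma> u / K \<le> a" using lux[of a] K by (simp add: divide_le_eq mult.commute)
    qed
    then have "lux_norm \<Omega> \<gamma> u \<le> K * ?W" using K by (simp add: divide_le_eq mult.commute)
    moreover have "var_modular \<Omega> \<gamma> (\<lambda>x. u x / (?W + 1)) < \<infinity>"
      using mod[of "?W + 1"] by (simp add: le_less_trans)
    then have "u \<in> Lvar \<Omega> \<gamma>"
      using W um by (auto simp: Lvar_def set_borel_measurable_iff intro!: exI[of _ "?W + 1"])
    ultimately show ?thesis by simp
  qed
  then show ?thesis using K by (intro exI[of _ K]) auto
qed

section \<open>The compact embedding\<close>

lemma exponent_gap: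
  assumes ne: "\<Omega> \<noteq> {}" and \<gamma>: "continuous_on (closure \<Omega>) \<gamma>"
    "\<And>x. x \<in> closure \<Omega> \<Longrightarrow> \<gamma> x < crit_exp s p x"
  obtains \<epsilon> where "0 < \<epsilon>" "\<And>x. x \<in> closure \<Omega> \<Longrightarrow> \<gamma> x + \<epsilon> < crit_exp s p x"
proof -
  have diag: "continuous_on A (\<lambda>x. f x x)" if "continuous_on UNIV (\<lambda>(x, y). f x y)"
    for f :: "'a \<Rightarrow> 'a \<Rightarrow> real" and A
    using continuous_on_compose2[OF that continuous_on_Pair[OF continuous_on_id continuous_on_id], of A]
    by simp
  have "real DIM('a) - s x x * p x x \<noteq> 0" for x using subcritical[of x x] by linarith
  then have cont: "continuous_on (closure \<Omega>) (\<lambda>x. crit_exp s p x - \<gamma> x)"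
    unfolding crit_exp_def by (intro continuous_intros diag[OF cont_s] diag[OF cont_p] \<gamma>(1)) auto
  have cpt: "compact (closure \<Omega>)" "closure \<Omega> \<noteq> {}" using bounded_dom ne by auto
  obtain x0 where x0: "x0 \<in> closure \<Omega>"
      "\<And>x. x \<in> closure \<Omega> \<Longrightarrow> crit_exp s p x0 - \<gamma> x0 \<le> crit_exp s p x - \<gamma> x"
    using continuous_attains_inf[OF cpt cont] by blast
  \<comment> \<open>Half of the minimal gap keeps the inequality strict at every point.\<close>
  define \<epsilon> where "\<epsilon> = (crit_exp s p x0 - \<gamma> x0) / 2"
  have \<epsilon>: "\<epsilon> > 0" using \<gamma>(2)[OF x0(1)] by (simp add: \<epsilon>_def)
  show ?thesis
  proof (rule that[OF \<epsilon>])
    fix x assume "x \<in> closure \<Omega>"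
    moreover have "2 * \<epsilon> = crit_exp s p x0 - \<gamma> x0" by (simp add: \<epsilon>_def)
    ultimately have "2 * \<epsilon> \<le> crit_exp s p x - \<gamma> x" using x0(2) by (simp only:)
    then show "\<gamma> x + \<epsilon> < crit_exp s p x" using \<epsilon> by linarith
  qed
qed

text \<open>Interpolation between \<open>L\<^sup>1\<close> and the exponent
  \<open>g + \<epsilon>\<close>: \<open>T\<close> is taken so large that the part with the higher
  exponent is at most \<open>1/2\<close>; then the \<open>L\<^sup>1\<close> part, with its possibly
  large coefficient \<open>A\<close>, eventually falls below \<open>1/2\<close>. As \<open>b\<close>
  is arbitrary, this amounts to convergence in the Luxemburg norm.\<close>

lemma modular_difference_tendsto_0:
  fixes f :: "nat \<Rightarrow> 'a \<Rightarrow> real"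
  assumes [measurable]: "\<And>k. f k \<in> borel_measurable L" "v \<in> borel_measurable L" "g \<in> borel_measurable L"
    and g: "\<And>x. x \<in> \<Omega> \<Longrightarrow> 1 \<le> g x \<and> g x \<le> P" and \<epsilon>: "0 < \<epsilon>" and M: "0 \<le> M" and b: "0 < b"
    and bf: "\<And>k. (\<integral>\<^sup>+ x. ennreal (\<bar>f k x\<bar> powr (g x + \<epsilon>)) \<partial>L) \<le> ennreal M"
    and bv: "(\<integral>\<^sup>+ x. ennreal (\<bar>v x\<bar> powr (g x + \<epsilon>)) \<partial>L) \<le> ennreal M"
    and L1: "(\<lambda>k. \<integral>\<^sup>+ x. ennreal \<bar>f k x - v x\<bar> \<partial>L) \<longlonglongrightarrow> 0"
  shows "\<forall>\<^sub>F k in sequentially. (\<integral>\<^sup>+ x. ennreal (\<bar>(f k x - v x) / b\<bar> powr g x) \<partial>L) \<le> 1"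
proof -
  define D where "D = max 1 (2 / b) powr (P + \<epsilon>)"
  \<comment> \<open>\<open>Y\<close> is chosen so that \<open>T powr (- \<epsilon>) = 1 / Y\<close>
    and the factor \<open>2 * M\<close> from the two modular bounds leaves
    \<open>D * 2 * M / Y \<le> 1 / 2\<close>.\<close>
  define Y where "Y = max 1 (4 * D * M)"
  define T where "T = Y powr (1 / \<epsilon>)"
  define A where "A = T powr (P - 1) / b"
  have Y: "Y \<ge> 1" "4 * D * M \<le> Y" by (auto simp: Y_def)
  have T: "T \<ge> 1" using Y \<epsilon> by (simp add: T_def ge_one_powr_ge_zero)
  have Te: "T powr (- \<epsilon>) = 1 / Y" using Y \<epsilon> by (simp add: T_def powr_powr powr_minus_divide)
  have D: "D \<ge> 0" by (simp add: D_def)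
  have A: "A > 0" using T b by (simp add: A_def)
  have small: "T powr (- \<epsilon>) * D * (2 * M) \<le> 1 / 2" using Y unfolding Te by (simp add: field_simps)
  have "\<forall>\<^sub>F k in sequentially. (\<integral>\<^sup>+ x. ennreal \<bar>f k x - v x\<bar> \<partial>L) < ennreal (1 / (2 * A))"
    using A by (intro order_tendstoD[OF L1]) simp
  then show ?thesis
  proof eventually_elim
    case (elim k)
    have "(\<integral>\<^sup>+ x. ennreal (\<bar>(f k x - v x) / b\<bar> powr g x) \<partial>L) \<le>
       (\<integral>\<^sup>+ x. ennreal A * ennreal \<bar>f k x - v x\<bar> + ennreal (T powr (- \<epsilon>) * D) *
          (ennreal (\<bar>f k x\<bar> powr (g x + \<epsilon>)) + ennreal (\<bar>v x\<bar> powr (g x + \<epsilon>))) \<partial>L)"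
    proof (rule nn_integral_mono)
      fix x assume "x \<in> space L"
      then have gx: "1 \<le> g x" "g x \<le> P" using g by auto
      let ?w = "\<bar>(f k x - v x) / b\<bar>"
      have "?w powr g x \<le> T powr (P - 1) * ?w + T powr (- \<epsilon>) * ?w powr (g x + \<epsilon>)"
        using T gx \<epsilon> by (intro powr_interpolation) auto
      also have "T powr (P - 1) * ?w = A * \<bar>f k x - v x\<bar>" using b by (simp add: A_def abs_divide)
      also have "?w powr (g x + \<epsilon>) \<le> D * (\<bar>f k x\<bar> powr (g x + \<epsilon>) + \<bar>v x\<bar> powr (g x + \<epsilon>))"
        unfolding D_def using b gx \<epsilon> by (intro powr_quotient_diff_le) auto
      finally have "?w powr g x \<le> A * \<bar>f k x - v x\<bar>
          + T powr (- \<epsilon>) * D * (\<bar>f k x\<bar> powr (g x + \<epsilon>) + \<bar>v x\<bar> powr (g x + \<epsilon>))"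
        by (simp add: mult_left_mono mult.assoc)
      then show "ennreal (?w powr g x) \<le> ennreal A * ennreal \<bar>f k x - v x\<bar> + ennreal (T powr (- \<epsilon>) * D) *
          (ennreal (\<bar>f k x\<bar> powr (g x + \<epsilon>)) + ennreal (\<bar>v x\<bar> powr (g x + \<epsilon>)))"
        using A D by (simp add: ennreal_leI flip: ennreal_mult ennreal_plus)
    qed
    also have "\<dots> = ennreal A * (\<integral>\<^sup>+ x. ennreal \<bar>f k x - v x\<bar> \<partial>L) + ennreal (T powr (- \<epsilon>) * D) *
        ((\<integral>\<^sup>+ x. ennreal (\<bar>f k x\<bar> powr (g x + \<epsilon>)) \<partial>L) + (\<integral>\<^sup>+ x. ennreal (\<bar>v x\<bar> powr (g x + \<epsilon>)) \<partial>L))"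
      by (simp add: nn_integral_add nn_integral_cmult)
    also have "\<dots> \<le> ennreal A * ennreal (1 / (2 * A)) + ennreal (T powr (- \<epsilon>) * D) * (ennreal M + ennreal M)"
      using elim bf bv by (intro add_mono mult_left_mono) auto
    also have "ennreal M + ennreal M = ennreal (2 * M)" using M by (simp flip: ennreal_plus)
    also have "ennreal A * ennreal (1 / (2 * A)) + ennreal (T powr (- \<epsilon>) * D) * ennreal (2 * M)
        = ennreal (A * (1 / (2 * A)) + T powr (- \<epsilon>) * D * (2 * M))"
    proof -
      have "ennreal A * ennreal (1 / (2 * A)) = ennreal (A * (1 / (2 * A)))"
        using A by (intro ennreal_mult[symmetric]) auto
      moreover have "ennreal (T powr (- \<epsilon>) * D) * ennreal (2 * M) = ennreal (T powr (- \<epsilon>) * D * (2 * M))"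
        using D M by (intro ennreal_mult[symmetric]) auto
      ultimately show ?thesis using A D M by (subst ennreal_plus) auto
    qed
    also have "\<dots> \<le> ennreal 1" using small A by (intro ennreal_leI) simp
    finally show ?case by simp
  qed
qed

text \<open>One constant \<open>a\<close> normalises the whole sequence, and a subsequence converges
  in \<open>L\<^sup>1\<close> and almost everywhere. The exponent gap bounds the modular with
  exponent \<open>\<gamma> + \<epsilon>\<close> along the sequence, Fatou does so for the limit, and
  interpolation upgrades the convergence.\<close>

lemma embedding_compact:
  assumes ne: "\<Omega> \<noteq> {}"
    and \<beta>: "continuous_on (closure \<Omega>) \<beta>" "\<And>x. x \<in> closure \<Omega> \<Longrightarrow> 1 \<le> \<beta> x"
    and \<gamma>: "continuous_on (closure \<Omega>) \<gamma>" "\<And>x. x \<in> closure \<Omega> \<Longrightarrow> 1 \<le> \<gamma> x"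
      "\<And>x. x \<in> closure \<Omega> \<Longrightarrow> \<gamma> x < crit_exp s p x"
    and f: "\<And>k. f k \<in> Wspace \<Omega> s \<beta> p" "bounded (range (\<lambda>k. W_norm \<Omega> s \<beta> p (f k)))"
  shows "\<exists>r v. strict_mono (r :: nat \<Rightarrow> nat) \<and> v \<in> Lvar \<Omega> \<gamma> \<and>
     (\<lambda>k. lux_norm \<Omega> \<gamma> (\<lambda>x. f (r k) x - v x)) \<longlonglongrightarrow> 0"
proof -
  define M0 where "M0 = measure L \<Omega> + 1"
  have M0: "0 \<le> M0" by (simp add: M0_def)
  obtain B where B: "\<And>k. \<bar>W_norm \<Omega> s \<beta> p (f k)\<bar> \<le> B" using f(2) by (auto simp: bounded_iff)
  \<comment> \<open>The summand \<open>1\<close> puts \<open>a\<close> strictly above every norm, as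
    \<open>Wspace_normalised\<close> requires, and makes it positive.\<close>
  define a where "a = B + 1"
  have Wa: "W_norm \<Omega> s \<beta> p (f k) < a" for k using B[of k] by (simp add: a_def)
  have a: "a > 0" using B[of 0] by (simp add: a_def)
  define h where "h = (\<lambda>k x. f k x / a)"
  have h: "controlled M0 (h k)" for k
    unfolding h_def M0_def by (rule Wspace_normalised(2)[OF \<beta> f(1) Wa])
  have hm [measurable]: "h k \<in> borel_measurable L" for k using h by (simp add: controlled_def)
  have \<gamma>m [measurable]: "\<gamma> \<in> borel_measurable L" by (rule continuous_exponent_measurable[OF \<gamma>(1)])
  obtain \<epsilon> where \<epsilon>: "0 < \<epsilon>" "\<And>x. x \<in> closure \<Omega> \<Longrightarrow> \<gamma> x + \<epsilon> < crit_exp s p x"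
    using exponent_gap[OF ne \<gamma>(1,3)] by blast
  have nonneg: "0 \<le> \<gamma> x + \<epsilon>" if "x \<in> closure \<Omega>" for x using \<gamma>(2)[OF that] \<epsilon>(1) by simp
  have "continuous_on (closure \<Omega>) (\<lambda>x. \<gamma> x + \<epsilon>)" by (intro continuous_intros \<gamma>(1))
  then obtain M where M: "0 \<le> M" "\<And>u. controlled M0 u \<Longrightarrow>
      (\<integral>\<^sup>+ y. ennreal (\<bar>u y\<bar> powr (\<gamma> y + \<epsilon>)) \<partial>L) \<le> ennreal M"
    using uniform_modular_bound[OF _ nonneg \<epsilon>(2) M0] by blast
  have "compact (\<gamma> ` closure \<Omega>)" using \<gamma>(1) bounded_dom by (intro compact_continuous_image) auto
  then have "bdd_above (\<gamma> ` closure \<Omega>)" by (simp add: bounded_imp_bdd_above compact_imp_bounded)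
  then obtain P where P: "\<And>x. x \<in> closure \<Omega> \<Longrightarrow> \<gamma> x \<le> P" by (auto simp: bdd_above_def)
  obtain r1 where r1: "strict_mono (r1 :: nat \<Rightarrow> nat)" and cau: "\<And>\<epsilon>. \<epsilon> > 0 \<Longrightarrow>
      \<exists>k0. \<forall>j\<ge>k0. \<forall>k\<ge>k0. (\<integral>\<^sup>+ x. ennreal \<bar>h (r1 j) x - h (r1 k) x\<bar> \<partial>L) \<le> ennreal \<epsilon>"
    using controlled_L1_precompact[of M0 h, OF h M0] by blast
  obtain r2 v where r2: "strict_mono (r2 :: nat \<Rightarrow> nat)" and vm [measurable]: "v \<in> borel_measurable L"
    and AEv: "AE x in L. (\<lambda>k. h (r1 (r2 k)) x) \<longlonglongrightarrow> v x"
    and L1: "(\<lambda>k. \<integral>\<^sup>+ x. ennreal \<bar>h (r1 (r2 k)) x - v x\<bar> \<partial>L) \<longlonglongrightarrow> 0"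
    using L1_Cauchy_imp_subseq_limit[of "\<lambda>k. h (r1 k)" L, OF hm cau] by blast
  have bv: "(\<integral>\<^sup>+ x. ennreal (\<bar>v x\<bar> powr (\<gamma> x + \<epsilon>)) \<partial>L) \<le> ennreal M"
  proof (rule nn_integral_le_of_AE_limit[where g = "\<lambda>k x. ennreal (\<bar>h (r1 (r2 k)) x\<bar> powr (\<gamma> x + \<epsilon>))"])
    show "AE x in L. (\<lambda>k. ennreal (\<bar>h (r1 (r2 k)) x\<bar> powr (\<gamma> x + \<epsilon>))) \<longlonglongrightarrow> ennreal (\<bar>v x\<bar> powr (\<gamma> x + \<epsilon>))"
      using AEv AE_space
    proof eventually_elim
      case (elim x)
      then have "1 \<le> \<gamma> x" using \<gamma>(2) closure_subset by auto
      then show ?case using elim \<epsilon>(1)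
        by (intro tendsto_ennrealI tendsto_powr' tendsto_rabs tendsto_const) auto
    qed
    show "\<forall>\<^sub>F k in sequentially. (\<integral>\<^sup>+ x. ennreal (\<bar>h (r1 (r2 k)) x\<bar> powr (\<gamma> x + \<epsilon>)) \<partial>L) \<le> ennreal M"
      using M(2)[OF h] by simp
  qed measurable
  \<comment> \<open>The factor \<open>a\<close> undoes the normalisation of the sequence.\<close>
  define V where "V = (\<lambda>x. a * v x)"
  have [measurable]: "V \<in> borel_measurable L" by (simp add: V_def)
  have "var_modular \<Omega> \<gamma> (\<lambda>x. V x / a) \<le> (\<integral>\<^sup>+ x. 1 + ennreal (\<bar>v x\<bar> powr (\<gamma> x + \<epsilon>)) \<partial>L)"
    unfolding var_modular_eq
  proof (rule nn_integral_mono)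
    fix x assume "x \<in> space L"
    then have "1 \<le> \<gamma> x" using \<gamma>(2) closure_subset by auto
    then have "\<bar>V x / a\<bar> powr \<gamma> x \<le> 1 + \<bar>v x\<bar> powr (\<gamma> x + \<epsilon>)"
      using a \<epsilon>(1) powr_le_one_plus_powr[of "\<bar>v x\<bar>" "\<gamma> x" "\<gamma> x + \<epsilon>"] by (simp add: V_def)
    then have "ennreal (\<bar>V x / a\<bar> powr \<gamma> x) \<le> ennreal (1 + \<bar>v x\<bar> powr (\<gamma> x + \<epsilon>))" by (rule ennreal_leI)
    then show "ennreal (\<bar>V x / a\<bar> powr \<gamma> x) \<le> 1 + ennreal (\<bar>v x\<bar> powr (\<gamma> x + \<epsilon>))" by simp
  qed
  also have "\<dots> = emeasure L \<Omega> + (\<integral>\<^sup>+ x. ennreal (\<bar>v x\<bar> powr (\<gamma> x + \<epsilon>)) \<partial>L)"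
    by (subst nn_integral_add) auto
  also have "\<dots> < \<infinity>" using bv by (auto simp: emeasure_eq_measure intro: le_less_trans)
  finally have VL: "V \<in> Lvar \<Omega> \<gamma>"
    using a by (auto simp: Lvar_def set_borel_measurable_iff)
  have "(\<lambda>k. lux_norm \<Omega> \<gamma> (\<lambda>x. f ((r1 \<circ> r2) k) x - V x)) \<longlonglongrightarrow> 0"
  proof (rule LIMSEQ_I)
    fix e :: real assume e: "e > 0"
    have gam: "1 \<le> \<gamma> x \<and> \<gamma> x \<le> P" if "x \<in> \<Omega>" for x using \<gamma>(2) P closure_subset that by blast
    \<comment> \<open>The target norm for \<open>f (r1 (r2 k)) - V\<close> is \<open>e / 2\<close>;
      dividing it by \<open>a\<close> expresses it for the normalised functions.\<close>
    have "\<forall>\<^sub>F k in sequentially. (\<integral>\<^sup>+ x. ennreal (\<bar>(h (r1 (r2 k)) x - v x) / (e / 2 / a)\<bar> powr \<gamma> x) \<partial>L) \<le> 1"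
      by (rule modular_difference_tendsto_0[OF hm vm \<gamma>m gam \<epsilon>(1) M(1) _ M(2)[OF h] bv L1]) (use a e in auto)
    then obtain k0 where k0: "\<And>k. k \<ge> k0 \<Longrightarrow>
        (\<integral>\<^sup>+ x. ennreal (\<bar>(h (r1 (r2 k)) x - v x) / (e / 2 / a)\<bar> powr \<gamma> x) \<partial>L) \<le> 1"
      by (auto simp: eventually_sequentially)
    have "norm (lux_norm \<Omega> \<gamma> (\<lambda>x. f ((r1 \<circ> r2) k) x - V x) - 0) < e" if k: "k \<ge> k0" for k
    proof -
      have eq: "(f (r1 (r2 k)) x - V x) / (e / 2) = (h (r1 (r2 k)) x - v x) / (e / 2 / a)" for x
        using a e by (simp add: h_def V_def field_simps)
      have mod: "var_modular \<Omega> \<gamma> (\<lambda>x. (f (r1 (r2 k)) x - V x) / (e / 2)) \<le> 1"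
        unfolding var_modular_eq eq by (rule k0[OF k])
      then have "lux_norm \<Omega> \<gamma> (\<lambda>x. f (r1 (r2 k)) x - V x) \<le> e / 2"
        using e by (intro lux_norm_le) auto
      \<comment> \<open>\<open>Inf\<close> of an empty set of reals is unspecified, so
        \<open>e / 2\<close> is supplied as an element of the set.\<close>
      moreover have "0 \<le> lux_norm \<Omega> \<gamma> (\<lambda>x. f (r1 (r2 k)) x - V x)"
        unfolding lux_norm_def using mod e by (intro cInf_greatest) (auto intro!: exI[of _ "e / 2"])
      ultimately show ?thesis using e by simp
    qed
    then show "\<exists>no. \<forall>k\<ge>no. norm (lux_norm \<Omega> \<gamma> (\<lambda>x. f ((r1 \<circ> r2) k) x - V x) - 0) < e" by blast
  qed
  moreover have "strict_mono (r1 \<circ> r2)" using r1 r2 by (rule strict_mono_o)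
  ultimately show ?thesis using VL by (intro exI[of _ "r1 \<circ> r2"] exI[of _ V]) auto
qed

end

section \<open>From the hypotheses of the theorem to the locale\<close>

lemma C_plus_imp:
  assumes "C_plus D \<Phi>"
  shows "continuous_on D \<Phi>" "\<And>x. x \<in> D \<Longrightarrow> 1 < \<Phi> x"
  using assms by (auto simp: C_plus_def intro: less_le_trans cInf_lower)

theorem theorem3p1:
  fixes \<Omega> :: "'a::euclidean_space set"
    and s p :: "'a \<Rightarrow> 'a \<Rightarrow> real"
    and \<beta> \<gamma> :: "'a \<Rightarrow> real"
  assumes "DIM('a) \<ge> 2"
    and "smooth_bounded_domain \<Omega>"
    and "continuous_on UNIV (\<lambda>(x, y). s x y)"
    and "\<forall>x y. s x y = s y x"
    and "bdd_above (range (\<lambda>(x, y). s x y))"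
    and "bdd_below (range (\<lambda>(x, y). s x y))"
    and "0 < Inf (range (\<lambda>(x, y). s x y))"
    and "Sup (range (\<lambda>(x, y). s x y)) < 1"
    and "C_plus UNIV (\<lambda>(x, y). p x y)"
    and "\<forall>x y. p x y = p y x"
    and "Sup (range (\<lambda>(x, y). s x y)) * Sup (range (\<lambda>(x, y). p x y)) < real DIM('a)"
    and "C_plus (closure \<Omega>) \<beta>"
    and "\<forall>x\<in>closure \<Omega>. p x x \<le> \<beta> x"
    and "C_plus (closure \<Omega>) \<gamma>"
    and "\<forall>x\<in>closure \<Omega>. \<gamma> x < crit_exp s p x"
  shows "(\<exists>K>0. \<forall>u\<in>Wspace \<Omega> s \<beta> p.
            u \<in> Lvar \<Omega> \<gamma> \<and> lux_norm \<Omega> \<gamma> u \<le> K * W_norm \<Omega> s \<beta> p u)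
       \<and> (\<forall>f :: nat \<Rightarrow> 'a \<Rightarrow> real.
            (\<forall>k. f k \<in> Wspace \<Omega> s \<beta> p) \<and> bounded (range (\<lambda>k. W_norm \<Omega> s \<beta> p (f k)))
            \<longrightarrow> (\<exists>r v. strict_mono r \<and> v \<in> Lvar \<Omega> \<gamma> \<and>
                   (\<lambda>k. lux_norm \<Omega> \<gamma> (\<lambda>x. f (r k) x - v x)) \<longlonglongrightarrow> 0))"
proof -
  define \<sigma> where "\<sigma> = Inf (range (\<lambda>(x, y). s x y))"
  have \<sigma>: "\<sigma> \<le> s x y" for x y
    unfolding \<sigma>_def by (rule cInf_lower) (use assms in auto)
  have s_le: "s x y \<le> Sup (range (\<lambda>(x, y). s x y))" for x y
    by (rule cSup_upper) (use assms in auto)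
  have p_le: "p x y \<le> Sup (range (\<lambda>(x, y). p x y))" for x y
    by (rule cSup_upper) (use assms(9) in \<open>auto simp: C_plus_def\<close>)
  have s_pos: "0 < s x y" for x y using assms(7) \<sigma>[of x y] by (simp add: \<sigma>_def)
  have p1: "1 < p x y" for x y using C_plus_imp(2)[OF assms(9), of "(x, y)"] by simp
  obtain c R where cR: "0 < c" "0 < R" "R \<le> 1"
    "\<And>x r. \<lbrakk>x \<in> \<Omega>; 0 < r; r \<le> R\<rbrakk> \<Longrightarrow> c * r ^ DIM('a) \<le> measure lebesgue (\<Omega> \<inter> ball x r)"
    using smooth_bounded_domain_measure_density[OF assms(2)] by blast
  have dom: "open \<Omega>" "bounded \<Omega>" "\<Omega> \<noteq> {}" using assms(2) by (auto simp: smooth_bounded_domain_def)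
  interpret fractional_domain \<Omega> s p \<sigma> c R
  proof
    fix x y
    \<comment> \<open>Positivity of \<open>s\<close> and \<open>p\<close> lets the product of the
      suprema dominate every product of values.\<close>
    have "s x y * p x y \<le> Sup (range (\<lambda>(x, y). s x y)) * Sup (range (\<lambda>(x, y). p x y))"
      using s_le[of x y] p_le[of x y] s_pos[of x y] p1[of x y] by (intro mult_mono) auto
    then show "s x y * p x y < real DIM('a)" using assms(11) by linarith
  next
    fix x r assume "x \<in> \<Omega>" "0 < r" "r \<le> R"
    then show "c * r powr real DIM('a) \<le> measure lebesgue (\<Omega> \<inter> ball x r)"
      using cR(4)[of x r] by (simp add: powr_realpow)
  qed (use dom assms(3,7) \<sigma> p1 cR C_plus_imp(1)[OF assms(9)] in \<open>auto simp: \<sigma>_def\<close>)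
  have \<beta>: "continuous_on (closure \<Omega>) \<beta>" "\<And>x. x \<in> closure \<Omega> \<Longrightarrow> 1 \<le> \<beta> x"
    using C_plus_imp[OF assms(12)] by (auto intro: less_imp_le)
  have \<gamma>: "continuous_on (closure \<Omega>) \<gamma>" "\<And>x. x \<in> closure \<Omega> \<Longrightarrow> 1 \<le> \<gamma> x"
    "\<And>x. x \<in> closure \<Omega> \<Longrightarrow> \<gamma> x < crit_exp s p x"
    using C_plus_imp[OF assms(14)] assms(15) by (auto intro: less_imp_le)
  show ?thesis
    using embedding_bounded[OF \<beta> \<gamma>] embedding_compact[OF dom(3) \<beta> \<gamma>] by blast
qed

end
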